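(* Let $1\le p<\infty$. Suppose that there exists a randomized data structure for the ANN problem in $\ell_p$-products of $\ell_2$, with space in $S(n)$, preprocessing time $T(n)$ and query time $Q(n)$, with probability of failure less than $2^{-4m-1}$. Then there exists a data structure for the ANN problem for the $\ell_p$-distance of polygonal curves, with space in $(4e)^{m+1}\cdot S(n)$, preprocessing time $(4e)^{m+1}\cdot T(n)$ and query time $(4e)^{m+1}\cdot Q(n)$, where $m$ denotes the maximum length of a polygonal curve, and the probability of failure is less than $1/2$.
   Context: A polygonal curve of length $m_1$ in $\mathbb{R}^d$ is a finite sequence $V=v_1,\dots,v_{m_1}$ of points of $\mathbb{R}^d$. Traversal: given polygonal curves $V=v_1,\dots,v_{m_1}$ and $U=u_1,\dots,u_{m_2}$, a traversal $T=[(i_1,j_1),\dots,(i_t,j_t)]$ is a sequence of pairs of indices such that $i_1=j_1=1$, $i_t=m_1$, $j_t=m_2$; for all $k$, $i_{k+1}-i_k\in\{0,1\}$ and $j_{k+1}-j_k\in\{0,1\}$; and for all $k$, $(i_{k+1}-i_k)+(j_{k+1}-j_k)\ge 1$. $\ell_p$-distance of polygonal curves: $\mathrm{d}_p(V,U)=\min_{T\in\mathcal{T}}\left(\sum_{(i,j)\in T}\|v_i-u_j\|_2^p\right)^{1/p}$, where $\mathcal{T}$ is the set of all traversals of $V$ and $U$. $\ell_p$-product of $\ell_2$: for point sequences $x=(x_1,\dots,x_l)$ and $y=(y_1,\dots,y_l)$ of points of $\mathbb{R}^d$, the distance is $\left(\sum_{i=1}^l\|x_i-y_i\|_2^p\right)^{1/p}$.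 ANN problem for a distance function $\mathrm{d}$ and approximation parameter $\epsilon>0$: preprocess $n$ given objects $V_1,\dots,V_n$ (point sequences or polygonal curves) into a data structure such that, for any query object $Q$, the data structure reports some $V_j$ with $\mathrm{d}(Q,V_j)\le(1+\epsilon)\,\mathrm{d}(Q,V_i)$ for all $i\in\{1,\dots,n\}$. The same $\epsilon$ is used in the hypothesis and in the conclusion. *)

theory Defs
  imports "HOL-Probability.Probability"
begin

definition traversal :: "nat \<Rightarrow> nat \<Rightarrow> (nat \<times> nat) list \<Rightarrow> bool" where
  "traversal m1 m2 T \<longleftrightarrow>
     T \<noteq> [] \<and> hd T = (1, 1) \<and> last T = (m1, m2) \<and>
     (\<forall>k. Suc k < length T \<longrightarrow>
        (let di = int (fst (T ! Suc k)) - int (fst (T ! k));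
             dj = int (snd (T ! Suc k)) - int (snd (T ! k))
         in di \<in> {0, 1} \<and> dj \<in> {0, 1} \<and> di + dj \<ge> 1))"

text \<open>Traversals index the vertices from 1, lists from 0.\<close>

definition curve_dist :: "real \<Rightarrow> (real ^ 'd) list \<Rightarrow> (real ^ 'd) list \<Rightarrow> real" where
  "curve_dist p V U =
     Min {(\<Sum>(i, j)\<leftarrow>T. norm (V ! (i - 1) - U ! (j - 1)) powr p) powr (1 / p) | T.
            traversal (length V) (length U) T}"

definition lp_product_dist :: "real \<Rightarrow> (real ^ 'd) list \<Rightarrow> (real ^ 'd) list \<Rightarrow> real" where
  "lp_product_dist p x y =
     (\<Sum>i<length x. norm (x ! i - y ! i) powr p) powr (1 / p)"

definition point_sequences :: "nat \<Rightarrow> (real ^ 'd) list set" where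
  "point_sequences l = {x. length x = l}"

definition curves_upto :: "nat \<Rightarrow> (real ^ 'd) list set" where
  "curves_upto m = {V. 1 \<le> length V \<and> length V \<le> m}"


text \<open>
  Programs work on an infinite array of real cells (a cell that was never written reads as 0) and
  have read access to the input, a list of objects, each of which is a list of numbers. Every
  instruction and every test takes one unit of time. A cell used as an address or as an index is
  rounded down; reads beyond the input give 0.

  \<^item> \<open>Load a b\<close> and \<open>Store a b\<close> are the indirect accesses \<open>M[a] := M[M[b]]\<close> and \<open>M[M[a]] := M[b]\<close>.
  \<^item> \<open>Sample a D\<close> writes a fresh, independent random number with the discrete law \<open>D\<close>.
  \<^item> \<open>Count a\<close>, \<open>Size a b\<close>, \<open>Get a b c\<close> write the number of input objects, the number of entries
    of object \<open>M[b]\<close>, and entry \<open>M[c]\<close> of object \<open>M[b]\<close>.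
\<close>

datatype arith = Add | Sub | Mul | Div | Pow

datatype instr =
    Const nat real
  | Arith arith nat nat nat
  | Floor nat nat
  | Load nat nat
  | Store nat nat
  | Sample nat "real pmf"
  | Count nat
  | Size nat nat
  | Get nat nat nat

datatype stmt =
    Instr instr
  | IfLe nat nat "stmt list" "stmt list"
  | WhileLe nat nat "stmt list"

type_synonym prog = "stmt list"
type_synonym mem = "nat \<Rightarrow> real option"

definition cell :: "mem \<Rightarrow> nat \<Rightarrow> real" where
  "cell M a = (case M a of None \<Rightarrow> 0 | Some x \<Rightarrow> x)"

definition index_cell :: "mem \<Rightarrow> nat \<Rightarrow> nat" where
  "index_cell M a = nat \<lfloor>cell M a\<rfloor>"

definition object :: "real list list \<Rightarrow> nat \<Rightarrow> real list" where
  "object I i = (if i < length I then I ! i else [])"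

definition entry :: "real list \<Rightarrow> nat \<Rightarrow> real" where
  "entry x i = (if i < length x then x ! i else 0)"

fun arith_op :: "arith \<Rightarrow> real \<Rightarrow> real \<Rightarrow> real" where
  "arith_op Add x y = x + y"
| "arith_op Sub x y = x - y"
| "arith_op Mul x y = x * y"
| "arith_op Div x y = x / y"
| "arith_op Pow x y = x powr y"

fun exec :: "real list list \<Rightarrow> instr \<Rightarrow> mem \<Rightarrow> mem pmf" where
  "exec I (Const a x) M = return_pmf (M(a \<mapsto> x))"
| "exec I (Arith f a b c) M = return_pmf (M(a \<mapsto> arith_op f (cell M b) (cell M c)))"
| "exec I (Floor a b) M = return_pmf (M(a \<mapsto> of_int \<lfloor>cell M b\<rfloor>))"
| "exec I (Load a b) M = return_pmf (M(a \<mapsto> cell M (index_cell M b)))"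
| "exec I (Store a b) M = return_pmf (M(index_cell M a \<mapsto> cell M b))"
| "exec I (Sample a D) M = map_pmf (\<lambda>x. M(a \<mapsto> x)) D"
| "exec I (Count a) M = return_pmf (M(a \<mapsto> real (length I)))"
| "exec I (Size a b) M = return_pmf (M(a \<mapsto> real (length (object I (index_cell M b)))))"
| "exec I (Get a b c) M =
     return_pmf (M(a \<mapsto> entry (object I (index_cell M b)) (index_cell M c)))"

fun step :: "real list list \<Rightarrow> prog \<times> mem \<Rightarrow> (prog \<times> mem) pmf" where
  "step I ([], M) = return_pmf ([], M)"
| "step I (Instr i # P, M) = map_pmf (Pair P) (exec I i M)"
| "step I (IfLe a b P1 P2 # P, M) =
     return_pmf ((if cell M a \<le> cell M b then P1 else P2) @ P, M)"
| "step I (WhileLe a b P1 # P, M) =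
     return_pmf (if cell M a \<le> cell M b then P1 @ WhileLe a b P1 # P else P, M)"

fun steps :: "real list list \<Rightarrow> nat \<Rightarrow> prog \<times> mem \<Rightarrow> (prog \<times> mem) pmf" where
  "steps I 0 c = return_pmf c"
| "steps I (Suc t) c = bind_pmf (step I c) (steps I t)"

definition halts_within :: "real list list \<Rightarrow> prog \<Rightarrow> mem \<Rightarrow> nat \<Rightarrow> bool" where
  "halts_within I P M t \<longleftrightarrow> (\<forall>c \<in> set_pmf (steps I t (P, M)). fst c = [])"

definition memory_after :: "real list list \<Rightarrow> prog \<Rightarrow> mem \<Rightarrow> nat \<Rightarrow> mem pmf" where
  "memory_after I P M t = map_pmf snd (steps I t (P, M))"


definition coords :: "real ^ 'd \<Rightarrow> real list" where
  "coords x = map (\<lambda>i. x $ i) (SOME is. distinct is \<and> set is = UNIV)"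

definition encode :: "(real ^ 'd) list \<Rightarrow> real list" where
  "encode V = concat (map coords V)"

definition input_size :: "real list list \<Rightarrow> nat" where
  "input_size I = sum_list (map length I)"

definition ann_answer :: "('a \<Rightarrow> 'a \<Rightarrow> real) \<Rightarrow> real \<Rightarrow> 'a list \<Rightarrow> 'a \<Rightarrow> nat \<Rightarrow> bool" where
  "ann_answer d \<epsilon> X q j \<longleftrightarrow>
     j < length X \<and> (\<forall>i<length X. d q (X ! j) \<le> (1 + \<epsilon>) * d q (X ! i))"

text \<open>
  A data structure is a pair of programs. The first one preprocesses the given objects, starting
  from the empty memory; the second one continues from the memory left by the first, has the query
  as an additional last input object, and reports an index in cell 0. Both programs are the same
  for every number of objects.

  The given objects stay accessible and count towards the space, and reading in the objects
  (respectively the query) counts towards the preprocessing (respectively query) time, one unit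
  per number. Since cells are never freed, the memory left by the preprocessing consists of all
  cells written during it. Time and space bounds hold for all random choices; the failure
  probability is, for each fixed input and query, over the random choices of both programs.
\<close>

definition ann_structure ::
  "(real ^ 'd) list set \<Rightarrow> ((real ^ 'd) list \<Rightarrow> (real ^ 'd) list \<Rightarrow> real) \<Rightarrow> real \<Rightarrow> real \<Rightarrow>
   (nat \<Rightarrow> real) \<Rightarrow> (nat \<Rightarrow> real) \<Rightarrow> (nat \<Rightarrow> real) \<Rightarrow> prog \<times> prog \<Rightarrow> bool" where
  "ann_structure Obj d \<epsilon> \<delta> S T Q = (\<lambda>(prep, query).
     \<forall>X. X \<noteq> [] \<and> set X \<subseteq> Obj \<longrightarrow>
       (let n = length X; I = map encode X in
        \<exists>t. halts_within I prep Map.empty t \<and>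
            real (input_size I + t) \<le> T n \<and>
            (\<forall>M \<in> set_pmf (memory_after I prep Map.empty t).
               real (input_size I + card (dom M)) \<le> S n) \<and>
            (\<forall>q \<in> Obj. let J = I @ [encode q] in
               \<exists>u. (\<forall>M \<in> set_pmf (memory_after I prep Map.empty t). halts_within J query M u) \<and>
                   real (length (encode q) + u) \<le> Q n \<and>
                   measure_pmf.prob
                     (bind_pmf (memory_after I prep Map.empty t) (\<lambda>M. memory_after J query M u))
                     {M. \<not> ann_answer d \<epsilon> X q (index_cell M 0)} < \<delta>)))"

end

theory Submission
  imports Defs
begin

text \<open>
  A traversal of two curves is a lattice walk; repeating vertices along the walk, and padding both
  results with zero vectors up to length \<open>2 * m - 1\<close>, turns the curves into point sequences whose
  product distance is the cost of the walk. Hence a single structure \<open>D\<close>, the one for sequences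
  of length \<open>2 * m - 1\<close>, suffices: one copy of \<open>D\<close> is kept for every walk. The copy of a walk
  must still hold exactly \<open>n\<close> objects, because nothing relates \<open>S\<close>, \<open>T\<close>, \<open>Q\<close> at different
  arguments, so a curve whose length does not fit the walk is replaced by a fixed curve that does.

  The copies are obtained by compiling the programs of \<open>D\<close>: each instruction becomes at most
  \<open>17 + 4 * m\<close> instructions that work in a separate part of the memory and translate every access
  to the input, so that the stretched curves are never written down. After each simulated query the
  exact cost of the reported candidate along the walk is computed, and the cheapest candidate is
  kept. It is at least as good as the candidate of the walk that realises the optimal distance, so
  only that one copy has to succeed and no union bound is needed. There are at most \<open>9 ^ m / 6\<close>
  walks, and the factor \<open>(4 * e / 9) ^ m\<close> left over pays for the simulation.
\<close>

section \<open>Running programs\<close>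

text \<open>A nearest curve, an optimal traversal to it, and hence the index \<open>h\<close> of the
  decisive copy depend only on the data and the query, not on the random choices. The composite run
  can therefore be compared with the run of \<open>D\<close> on copy \<open>h\<close> alone: a
  coupling (\<open>rel_pmf\<close>) keeps the law of that one simulated memory, while all other
  copies enter only through facts that hold on every outcome. No joint law of the copies has to be
  described. The other copies cannot do harm, because what they report is checked before it is used.
  The fixed overheads have to be charged to \<open>S\<close>, \<open>T\<close> and \<open>Q\<close>,
  functions about which only the hypothesis is known. This is possible because \<open>D\<close>
  itself must hold and read the stretched sequences, so that each bound is at least the size of its
  input.\<close>

definition triple :: "real list list \<Rightarrow> prog \<Rightarrow> mem \<Rightarrow> nat \<Rightarrow> (mem \<Rightarrow> bool) \<Rightarrow> bool" where
  "triple I P N t \<Phi> \<longleftrightarrow> (\<forall>c \<in> set_pmf (steps I t (P, N)). fst c = [] \<and> \<Phi> (snd c))"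

text \<open>A statement about supports such as \<open>triple\<close> forgets probabilities. Here
  \<open>\<mu>\<close> is the law of a simulated memory, and coupling it with the actual run lets
  events be carried over from one to the other. For a point mass this is \<open>triple\<close>
  again.\<close>

definition couples ::
  "'a pmf \<Rightarrow> real list list \<Rightarrow> prog \<Rightarrow> mem \<Rightarrow> nat \<Rightarrow> ('a \<Rightarrow> mem \<Rightarrow> bool) \<Rightarrow> bool" where
  "couples \<mu> I P N t R \<longleftrightarrow>
     rel_pmf (\<lambda>x c. fst c = [] \<and> R x (snd c)) \<mu> (steps I t (P, N))"

lemma steps_Nil [simp]: "steps I t ([], N) = return_pmf ([], N)"
  by (induction t) (auto simp: bind_return_pmf)

lemma step_append:
  "P \<noteq> [] \<Longrightarrow> step I (P @ P', N) = map_pmf (\<lambda>c. (fst c @ P', snd c)) (step I (P, N))"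
  by (cases "(I, (P, N))" rule: step.cases) (auto simp: map_pmf_comp o_def)

text \<open>If \<open>P\<close> halts early, \<open>P'\<close> starts early and receives more than
  \<open>t'\<close> steps. The equation still holds because \<open>P'\<close> has halted after
  \<open>t'\<close> steps on every outcome and a halted configuration no longer changes.\<close>

lemma steps_append:
  assumes "\<forall>c \<in> set_pmf (steps I t (P, N)).
    fst c = [] \<and> (\<forall>c' \<in> set_pmf (steps I t' (P', snd c)). fst c' = [])"
  shows "steps I (t + t') (P @ P', N)
    = bind_pmf (steps I t (P, N)) (\<lambda>c. steps I t' (P', snd c))"
  using assms
proof (induction t arbitrary: P N)
  case 0
  then show ?case by (simp add: bind_return_pmf)
next
  case (Suc t)
  show ?case
  proof (cases "P = []")
    case True
    have absorb: "steps I (s + t') (P', N) = steps I t' (P', N)" for s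
    proof -
      have add: "steps I (t' + s) c = bind_pmf (steps I t' c) (steps I s)" for c
        by (induction t' arbitrary: c) (auto simp: bind_return_pmf bind_assoc_pmf intro!: bind_pmf_cong)
      have "bind_pmf (steps I t' (P', N)) (steps I s) = bind_pmf (steps I t' (P', N)) return_pmf"
      proof (rule bind_pmf_cong[OF refl])
        fix c assume "c \<in> set_pmf (steps I t' (P', N))"
        then have "fst c = []" using Suc.prems True by auto
        then show "steps I s c = return_pmf c" by (cases c) simp
      qed
      then show ?thesis using add[of "(P', N)"] by (simp add: bind_return_pmf' add.commute)
    qed
    show ?thesis using absorb[of "Suc t"] True
      by (simp add: bind_return_pmf del: steps.simps)
  next
    case False
    have "steps I (Suc t + t') (P @ P', N)
      = bind_pmf (step I (P, N)) (\<lambda>c. steps I (t + t') (fst c @ P', snd c))"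
      by (simp add: step_append[OF False] bind_map_pmf)
    also have "\<dots> = bind_pmf (step I (P, N))
      (\<lambda>c. bind_pmf (steps I t c) (\<lambda>c. steps I t' (P', snd c)))"
    proof (rule bind_pmf_cong[OF refl])
      fix c assume "c \<in> set_pmf (step I (P, N))"
      then show "steps I (t + t') (fst c @ P', snd c)
        = bind_pmf (steps I t c) (\<lambda>c. steps I t' (P', snd c))"
        using Suc.IH[of "fst c" "snd c"] Suc.prems by (auto simp: set_bind_pmf)
    qed
    finally show ?thesis by (simp add: bind_assoc_pmf)
  qed
qed

lemma couples_return: "couples (return_pmf x) I P N t R \<longleftrightarrow> triple I P N t (R x)"
  by (auto simp: couples_def triple_def rel_pmf_return_pmf1)

lemma couples_support:
  "couples \<mu> I P N t R \<Longrightarrow> triple I P N t (\<lambda>N'. \<exists>x \<in> set_pmf \<mu>. R x N')"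
  unfolding couples_def triple_def by (drule rel_pmf_imp_rel_set) (unfold rel_set_def, blast)

lemma couples_append:
  assumes 1: "couples \<mu> I P N t R"
    and 2: "\<And>x N'. \<lbrakk>x \<in> set_pmf \<mu>; R x N'\<rbrakk> \<Longrightarrow> couples (\<nu> x) I P' N' t' R'"
  shows "couples (bind_pmf \<mu> \<nu>) I (P @ P') N (t + t') R'"
proof -
  have *: "fst c = [] \<and> (\<exists>x \<in> set_pmf \<mu>. R x (snd c))" if "c \<in> set_pmf (steps I t (P, N))" for c
    using couples_support[OF 1] that by (auto simp: triple_def)
  have "steps I (t + t') (P @ P', N)
    = bind_pmf (steps I t (P, N)) (\<lambda>c. steps I t' (P', snd c))"
  proof (rule steps_append, intro ballI conjI)
    fix c c' assume c: "c \<in> set_pmf (steps I t (P, N))"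
      and c': "c' \<in> set_pmf (steps I t' (P', snd c))"
    from *[OF c] obtain x where "x \<in> set_pmf \<mu>" "R x (snd c)" by auto
    from couples_support[OF 2[OF this]] c' show "fst c' = []" by (auto simp: triple_def)
  qed (use * in auto)
  moreover have "rel_pmf (\<lambda>x c. fst c = [] \<and> R' x (snd c)) (bind_pmf \<mu> \<nu>)
    (bind_pmf (steps I t (P, N)) (\<lambda>c. steps I t' (P', snd c)))"
  proof (rule rel_pmf_bindI)
    \<comment> \<open>A coupling lives on the supports of its marginals, so membership in
      \<open>set_pmf \<mu>\<close> may be added to the relation.\<close>
    show "rel_pmf (\<lambda>x c. x \<in> set_pmf \<mu> \<and> R x (snd c)) \<mu> (steps I t (P, N))"
      using 1 unfolding couples_def
      by (rule pmf.rel_mono_strong) auto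
  qed (use 2 in \<open>auto simp: couples_def\<close>)
  ultimately show ?thesis by (simp add: couples_def)
qed

lemma triple_append:
  assumes "triple I P N t \<Phi>" "\<And>N'. \<Phi> N' \<Longrightarrow> triple I P' N' t' \<Psi>"
  shows "triple I (P @ P') N (t + t') \<Psi>"
  using couples_append[of "return_pmf ()" I P N t "\<lambda>_. \<Phi>" return_pmf P' t' "\<lambda>_. \<Psi>"] assms
  by (simp add: couples_return bind_return_pmf)

lemma triple_conseq:
  "\<lbrakk>triple I P N t \<Phi>; t \<le> t'; \<And>N'. \<Phi> N' \<Longrightarrow> \<Psi> N'\<rbrakk> \<Longrightarrow> triple I P N t' \<Psi>"
  using triple_append[of I P N t \<Phi> "[]" "t' - t" \<Psi>] by (auto simp: triple_def)

lemma couples_mono: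
  assumes "couples \<mu> I P N t R" "t \<le> t'"
    "\<And>x N'. x \<in> set_pmf \<mu> \<Longrightarrow> R x N' \<Longrightarrow> R' x N'"
  shows "couples \<mu> I P N t' R'"
proof -
  have "couples (bind_pmf \<mu> return_pmf) I (P @ []) N (t + (t' - t)) R'"
    by (rule couples_append[OF assms(1)]) (use assms in \<open>auto simp: couples_return triple_def\<close>)
  with assms(2) show ?thesis by (simp add: bind_return_pmf')
qed

lemma triple_Nil [simp]: "triple I [] N t \<Phi> \<longleftrightarrow> \<Phi> N"
  by (simp add: triple_def)

lemma triple_Instr [simp]:
  "triple I (Instr i # P) N (Suc t) \<Phi> \<longleftrightarrow> (\<forall>N' \<in> set_pmf (exec I i N). triple I P N' t \<Phi>)"
  "triple I (Instr i # P) N (numeral v) \<Phi>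
     \<longleftrightarrow> (\<forall>N' \<in> set_pmf (exec I i N). triple I P N' (pred_numeral v) \<Phi>)"
  by (auto simp: triple_def set_bind_pmf numeral_eq_Suc)

lemma triple_IfLe [simp]:
  "triple I (IfLe a b P1 P2 # P) N (Suc t) \<Phi>
     \<longleftrightarrow> triple I ((if cell N a \<le> cell N b then P1 else P2) @ P) N t \<Phi>"
  "triple I (IfLe a b P1 P2 # P) N (numeral v) \<Phi>
     \<longleftrightarrow> triple I ((if cell N a \<le> cell N b then P1 else P2) @ P) N (pred_numeral v) \<Phi>"
  by (auto simp: triple_def bind_return_pmf numeral_eq_Suc)

lemma triple_WhileLe:
  "triple I (WhileLe a b P1 # P) N (Suc t) \<Phi>
     \<longleftrightarrow> triple I (if cell N a \<le> cell N b then P1 @ WhileLe a b P1 # P else P) N t \<Phi>"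
  by (auto simp: triple_def bind_return_pmf)

lemma cell_upd [simp]: "cell (N(a \<mapsto> x)) b = (if a = b then x else cell N b)"
  by (simp add: cell_def)

lemma halts_within_triple: "halts_within I P N t \<longleftrightarrow> triple I P N t (\<lambda>_. True)"
  by (simp add: halts_within_def triple_def)

lemma triple_memory_after:
  "triple I P N t \<Phi> \<Longrightarrow> N' \<in> set_pmf (memory_after I P N t) \<Longrightarrow> \<Phi> N'"
  by (auto simp: triple_def memory_after_def)

text \<open>\<open>card\<close> is 0 on infinite sets, so the space bound of \<open>D\<close> does
  not by itself show that its memory is finite. Each step writes at most one cell.\<close>

lemma finite_dom_memory_after:
  "finite (dom M) \<Longrightarrow> M' \<in> set_pmf (memory_after I P M t) \<Longrightarrow> finite (dom M')"
proof (induction t arbitrary: P M)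
  case (Suc t)
  have exec: "finite (dom N)" if "N \<in> set_pmf (exec I i M)" for i N
    using that Suc.prems(1) by (cases i) auto
  have "finite (dom (snd c))" if "c \<in> set_pmf (step I (P, M))" for c
    using that Suc.prems(1) exec by (cases "(I, (P, M))" rule: step.cases) auto
  then show ?case using Suc by (fastforce simp: memory_after_def set_bind_pmf)
qed (simp add: memory_after_def)

lemma couples_halts: "couples \<mu> I P N t R \<Longrightarrow> halts_within I P N t"
  using couples_support by (fastforce simp: halts_within_triple intro: triple_conseq)

lemma couples_memory_after: "couples \<mu> I P N t R \<Longrightarrow> rel_pmf R \<mu> (memory_after I P N t)"
  unfolding couples_def memory_after_def pmf.rel_map by (erule pmf.rel_mono_strong) auto

section \<open>Compiling a program to read its input through a view\<close>

text \<open>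
  Scratch cells: 0 holds the answer, 1 the index of the last data object, 2 the best score seen
  so far, 3 to 9 are temporary, 10 stays 0, and \<open>10 + i\<close> holds the representative \<open>\<rho> i\<close> of the
  data objects of length \<open>i\<close>. From \<open>11 + m\<close> on, the memories of the \<open>K\<close> simulated structures are
  interleaved.
\<close>

locale layout =
  fixes d L m K :: nat and A B :: "nat \<Rightarrow> nat list" and E F :: "nat \<Rightarrow> nat"
  assumes d_pos: "0 < d" and K_pos: "0 < K"
    and length_A: "\<And>k. k < K \<Longrightarrow> length (A k) = L"
    and length_B: "\<And>k. k < K \<Longrightarrow> length (B k) = L"
    and E_bounds: "\<And>k. k < K \<Longrightarrow> 1 \<le> E k \<and> E k \<le> m"
begin

text \<open>A copy may use arbitrarily high addresses, so no block size would separate the copies.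
  Residues modulo \<open>K\<close> do, and one multiplication and one addition compute the
  location.\<close>

definition loc :: "nat \<Rightarrow> nat \<Rightarrow> nat" where "loc k a = 11 + m + K * a + k"

lemma loc_inj: "\<lbrakk>k < K; k' < K\<rbrakk> \<Longrightarrow> loc k a = loc k' a' \<longleftrightarrow> k = k' \<and> a = a'"
proof
  assume k: "k < K" "k' < K" and "loc k a = loc k' a'"
  then have *: "K * a + k = K * a' + k'" by (simp add: loc_def)
  have "(K * a + k) mod K = k" "(K * a' + k') mod K = k'"
    "(K * a + k) div K = a" "(K * a' + k') div K = a'" using k by auto
  with * show "k = k' \<and> a = a'" by metis
qed auto

lemma loc_ge: "11 + m \<le> loc k a" by (simp add: loc_def)

definition part :: "nat \<Rightarrow> mem \<Rightarrow> mem" where "part k N a = N (loc k a)"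

lemma part_upd [simp]:
  "k < K \<Longrightarrow> part k (N(loc k a \<mapsto> x)) = (part k N)(a \<mapsto> x)"
  "k < K \<Longrightarrow> k' < K \<Longrightarrow> k \<noteq> k' \<Longrightarrow> part k' (N(loc k a \<mapsto> x)) = part k' N"
  "s < 11 + m \<Longrightarrow> part k (N(s \<mapsto> x)) = part k N"
proof -
  assume "s < 11 + m"
  then have "loc k a \<noteq> s" for a using loc_ge[of k a] by linarith
  then show "part k (N(s \<mapsto> x)) = part k N" by (auto simp: fun_eq_iff part_def)
qed (auto simp: loc_inj fun_eq_iff part_def)

lemma index_cell_upd [simp]:
  "index_cell (N(a \<mapsto> x)) b = (if a = b then nat \<lfloor>x\<rfloor> else index_cell N b)"
  by (simp add: index_cell_def)

lemma cell_loc: "cell N (loc k a) = cell (part k N) a"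
  by (simp add: cell_def part_def)

lemma index_cell_loc: "index_cell N (loc k a) = index_cell (part k N) a"
  by (simp add: index_cell_def cell_loc)

lemma loc_neq [simp]: "s < 11 + m \<Longrightarrow> loc k a \<noteq> s" "s < 11 + m \<Longrightarrow> s \<noteq> loc k a"
  using loc_ge[of k a] by auto

section \<open>Frame conditions and the scratch cells\<close>

abbreviation temp :: "nat set" where "temp \<equiv> {3..9}"

definition agree :: "nat set \<Rightarrow> mem \<Rightarrow> mem \<Rightarrow> bool" where
  "agree U N N' \<longleftrightarrow> (\<forall>a. a \<notin> U \<longrightarrow> N' a = N a)"

lemma agree_refl [simp]: "agree U N N" by (simp add: agree_def)

lemma agree_trans: "agree U N N' \<Longrightarrow> agree U N' N'' \<Longrightarrow> agree U N N''" by (simp add: agree_def)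

lemma agree_mono: "agree U N N' \<Longrightarrow> U \<subseteq> U' \<Longrightarrow> agree U' N N'" by (auto simp: agree_def)

lemma agree_upd [simp]: "a \<in> U \<Longrightarrow> agree U N (N'(a \<mapsto> x)) \<longleftrightarrow> agree U N N'"
  by (auto simp: agree_def)

lemma agree_cell: "agree U N N' \<Longrightarrow> a \<notin> U \<Longrightarrow> cell N' a = cell N a"
  by (simp add: agree_def cell_def)

lemma agree_loc: "agree U N N' \<Longrightarrow> (\<And>a. loc k a \<notin> U) \<Longrightarrow> part k N' = part k N"
  by (auto simp: agree_def fun_eq_iff part_def)

text \<open>The only test is \<le>, so for whole numbers \<open>j < n\<close> becomes a comparison
  with \<open>n - 1\<close> in cell 1. The simulation preserves the invariant because it writes none
  of these cells.\<close>

definition low :: "nat \<Rightarrow> (nat \<Rightarrow> nat) \<Rightarrow> mem \<Rightarrow> bool" where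
  "low n \<rho> N \<longleftrightarrow> cell N 1 = real n - 1 \<and> cell N 10 = 0 \<and>
     (\<forall>i \<in> {1..m}. cell N (10 + i) = real (\<rho> i))"

lemma low_agree: "low n \<rho> N \<Longrightarrow> agree U N N' \<Longrightarrow> U \<inter> ({1} \<union> {10..10 + m}) = {} \<Longrightarrow> low n \<rho> N'"
proof -
  assume *: "low n \<rho> N" "agree U N N'" "U \<inter> ({1} \<union> {10..10 + m}) = {}"
  have "cell N' a = cell N a" if "a = 1 \<or> a \<in> {10..10 + m}" for a
    using *(2) by (rule agree_cell) (use *(3) that in auto)
  with *(1) show ?thesis by (simp add: low_def)
qed

text \<open>The walk is built into the program: a chain of comparisons finds the vertex index for
  the position in cell 5. Positions past the end get \<open>m\<close>, an index beyond every curve,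
  where reading gives 0. This chain makes the slowdown depend on \<open>L\<close>.\<close>

fun table :: "nat \<Rightarrow> nat list \<Rightarrow> prog" where
  "table i [] = [Instr (Const 7 (real m))]"
| "table i (x # xs) = [Instr (Const 7 (real i)),
     IfLe 5 7 [Instr (Const 7 (real x))] (table (Suc i) xs)]"

text \<open>Equality is expressed by two opposite comparisons, and \<open>Floor\<close> serves to
  copy a whole number.\<close>

definition redirect :: "nat \<Rightarrow> prog" where
  "redirect k = [Instr (Size 7 3), Instr (Const 8 (real (E k * d))),
     IfLe 7 8 [IfLe 8 7 [] [Instr (Floor 3 (10 + E k))]] [Instr (Floor 3 (10 + E k))]]"

text \<open>\<open>index_cell\<close> turns negative values into 0. The clipping has to come before
  scaling and shifting, since afterwards a negative address would lead to a wrong cell.\<close>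

definition address :: "nat \<Rightarrow> nat \<Rightarrow> prog" where
  "address k b = [Instr (Floor 3 (loc k b)), IfLe 3 10 [Instr (Const 3 0)] [],
     Instr (Const 4 (real K)), Instr (Arith Mul 3 3 4),
     Instr (Const 4 (real (11 + m + k))), Instr (Arith Add 3 3 4)]"

text \<open>Besides relocating addresses, only \<open>Size\<close> and \<open>Get\<close> change
  values. All stretched sequences have the same length, so \<open>Size\<close> merely tells present
  objects from absent ones. \<open>Get\<close> splits the entry index into a position (cell 5) and a
  coordinate (cell 4), and the table turns the position into a vertex index.\<close>

fun compile_instr :: "nat \<Rightarrow> instr \<Rightarrow> prog" where
  "compile_instr k (Const a x) = [Instr (Const (loc k a) x)]"
| "compile_instr k (Arith f a b c) = [Instr (Arith f (loc k a) (loc k b) (loc k c))]"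
| "compile_instr k (Floor a b) = [Instr (Floor (loc k a) (loc k b))]"
| "compile_instr k (Load a b) = address k b @ [Instr (Load (loc k a) 3)]"
| "compile_instr k (Store a b) = address k a @ [Instr (Store 3 (loc k b))]"
| "compile_instr k (Sample a D) = [Instr (Sample (loc k a) D)]"
| "compile_instr k (Count a) = [Instr (Count (loc k a))]"
| "compile_instr k (Size a b) = [Instr (Size 3 (loc k b)),
     IfLe 3 10 [Instr (Const (loc k a) 0)] [Instr (Const (loc k a) (real (L * d)))]]"
| "compile_instr k (Get a b c) =
     [Instr (Floor 3 (loc k b)), Instr (Floor 4 (loc k c)), IfLe 4 10 [Instr (Const 4 0)] [],
      Instr (Const 6 (real d)), Instr (Arith Div 5 4 6), Instr (Floor 5 5),
      Instr (Arith Mul 7 5 6), Instr (Arith Sub 4 4 7)] @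
     [IfLe 3 1 (redirect k @ table 0 (A k)) (table 0 (B k))] @
     [Instr (Arith Mul 7 7 6), Instr (Arith Add 7 7 4), Instr (Get (loc k a) 3 7)]"

fun compile_stmt :: "nat \<Rightarrow> stmt \<Rightarrow> prog" where
  "compile_stmt k (Instr i) = compile_instr k i"
| "compile_stmt k (IfLe a b P1 P2) =
     [IfLe (loc k a) (loc k b) (concat (map (compile_stmt k) P1)) (concat (map (compile_stmt k) P2))]"
| "compile_stmt k (WhileLe a b P) = [WhileLe (loc k a) (loc k b) (concat (map (compile_stmt k) P))]"

abbreviation compile :: "nat \<Rightarrow> prog \<Rightarrow> prog" where
  "compile k P \<equiv> concat (map (compile_stmt k) P)"

definition redirected :: "nat \<Rightarrow> (nat \<Rightarrow> nat) \<Rightarrow> real list list \<Rightarrow> nat \<Rightarrow> nat" where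
  "redirected k \<rho> I j = (if length (object I j) = E k * d then j else \<rho> (E k))"

text \<open>\<open>I'\<close> is the input that copy \<open>k\<close> believes to read. The relation
  is stated for all indices, with default values, because a simulated program may also read outside
  its input.\<close>

definition view :: "nat \<Rightarrow> nat \<Rightarrow> (nat \<Rightarrow> nat) \<Rightarrow> real list list \<Rightarrow> real list list \<Rightarrow> bool" where
  "view k n \<rho> I' I \<longleftrightarrow> length I' = length I \<and>
     (\<forall>j. length (object I' j) = (if object I j = [] then 0 else L * d)) \<and>
     (\<forall>j e. entry (object I' j) e =
        entry (object I (if j < n then redirected k \<rho> I j else j))
          (nth_default m (if j < n then A k else B k) (e div d) * d + e mod d))"

section \<open>Correctness of the translated instructions\<close>

lemma triple_IfLe_single:
  assumes "triple I (if cell N a \<le> cell N b then P1 else P2) N t \<Phi>"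
  shows "triple I [IfLe a b P1 P2] N (1 + t) \<Phi>"
  using assms by simp

text \<open>Generalised to a chain that starts at \<open>i\<close>. Since
  \<open>i \<le> pos\<close>, the test \<open>pos \<le> i\<close> amounts to equality.\<close>

lemma triple_table:
  "\<lbrakk>cell N 5 = real pos; i \<le> pos\<rbrakk> \<Longrightarrow>
   triple I (table i xs) N (2 * length xs + 1)
     (\<lambda>N'. agree {7} N N' \<and> cell N' 7 = real (nth_default m xs (pos - i)))"
proof (induction xs arbitrary: i N)
  case Nil
  then show ?case by simp
next
  case (Cons x xs)
  show ?case
  proof (cases "pos = i")
    case False
    then have "nth_default m (x # xs) (pos - i) = nth_default m xs (pos - Suc i)"
      using Cons.prems nth_default_Cons_Suc[of m x xs "pos - Suc i"]
      by (simp add: Suc_diff_Suc del: nth_default_Cons_Suc)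
    moreover have "triple I (table (Suc i) xs) (N(7 \<mapsto> real i)) (2 * length xs + 1)
      (\<lambda>N'. agree {7} (N(7 \<mapsto> real i)) N' \<and> cell N' 7 = real (nth_default m xs (pos - Suc i)))"
    proof -
      have "cell (N(7 \<mapsto> real i)) 5 = real pos" "Suc i \<le> pos" using Cons.prems False by simp_all
      then show ?thesis by (rule Cons.IH)
    qed
    then have "triple I (table (Suc i) xs) (N(7 \<mapsto> real i)) (2 * length xs + 1)
      (\<lambda>N'. agree {7} N N' \<and> cell N' 7 = real (nth_default m xs (pos - Suc i)))"
      by (rule triple_conseq) (auto intro: agree_trans[of _ _ "N(7 \<mapsto> real i)"])
    ultimately show ?thesis using False Cons.prems by simp
  qed (use Cons.prems in simp)
qed

lemma triple_redirect:
  assumes "k < K" "low n \<rho> N"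
  shows "triple I (redirect k) N 5
    (\<lambda>N'. agree {3, 7, 8} N N' \<and> index_cell N' 3 = redirected k \<rho> I (index_cell N 3))"
  using assms E_bounds[OF assms(1)] of_nat_le_iff[where 'a=real]
  by (auto simp: redirect_def low_def index_cell_def redirected_def simp del: of_nat_mult of_nat_le_iff)

lemma triple_clip:
  assumes "cell N 10 = 0" "s \<noteq> 10"
  shows "triple I [Instr (Floor s a), IfLe s 10 [Instr (Const s 0)] []] N 3
    (\<lambda>N'. agree {s} N N' \<and> cell N' s = real (index_cell N a))"
  using assms by (auto simp: index_cell_def)

lemma triple_address:
  assumes "cell N 10 = 0"
  shows "triple I (address k b) N 7
    (\<lambda>N'. agree {3, 4} N N' \<and> index_cell N' 3 = loc k (index_cell (part k N) b))"
proof -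
  have "triple I ([Instr (Floor 3 (loc k b)), IfLe 3 10 [Instr (Const 3 0)] []] @
    [Instr (Const 4 (real K)), Instr (Arith Mul 3 3 4),
     Instr (Const 4 (real (11 + m + k))), Instr (Arith Add 3 3 4)]) N (3 + 4)
    (\<lambda>N'. agree {3, 4} N N' \<and> index_cell N' 3 = loc k (index_cell (part k N) b))"
  proof (rule triple_append[OF triple_clip[OF assms]])
    fix N' assume N': "agree {3} N N' \<and> cell N' 3 = real (index_cell N (loc k b))"
    define z where "z = index_cell N (loc k b)"
    have "real z * real K + real (11 + m + k) = real (loc k z)" by (simp add: loc_def)
    then have loc: "nat \<lfloor>real z * real K + real (11 + m + k)\<rfloor> = loc k z"
      by (simp only: floor_of_nat nat_int)
    have "agree {3, 4} N N'" using N' by (auto intro: agree_mono)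
    then show "triple I [Instr (Const 4 (real K)), Instr (Arith Mul 3 3 4),
      Instr (Const 4 (real (11 + m + k))), Instr (Arith Add 3 3 4)] N' 4
      (\<lambda>N'. agree {3, 4} N N' \<and> index_cell N' 3 = loc k (index_cell (part k N) b))"
      using N' loc by (simp add: z_def index_cell_loc del: of_nat_add)
  qed simp
  then show ?thesis by (simp add: address_def)
qed

lemma low_sim: "low n \<rho> N \<Longrightarrow> agree (temp \<union> range (loc k)) N N' \<Longrightarrow> low n \<rho> N'"
proof (erule low_agree)
  show "(temp \<union> range (loc k)) \<inter> ({1} \<union> {10..10 + m}) = {}"
    by (auto simp: disjoint_iff loc_def)
qed

text \<open>The slowest instruction sets the slowdown: 9 steps to split the entry index, 1 to choose
  the branch, 5 to redirect, \<open>2 * L + 1\<close> for the table and 3 for the read. With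
  \<open>L = 2 * m - 1\<close> this is \<open>17 + 4 * m\<close>.\<close>

lemma triple_Get:
  assumes k: "k < K" and low: "low n \<rho> N" and view: "view k n \<rho> I' I" and n: "0 < n"
  shows "triple I (compile_instr k (Get a b c)) N (19 + 2 * L)
    (\<lambda>N'. agree (temp \<union> range (loc k)) N N' \<and> part k N' = (part k N)
       (a \<mapsto> entry (object I' (index_cell (part k N) b)) (index_cell (part k N) c)))"
proof -
  define j where "j = index_cell (part k N) b"
  define e where "e = index_cell (part k N) c"
  define j' where "j' = (if j < n then redirected k \<rho> I j else j)"
  define q where "q = e div d"
  define r where "r = e mod d"
  define x where "x = nth_default m (if j < n then A k else B k) q"
  let ?T = "{3, 7, 8} :: nat set"
  let ?pre = "\<lambda>N1. agree temp N N1 \<and> index_cell N1 3 = j \<and>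
    cell N1 3 = real_of_int \<lfloor>cell N (loc k b)\<rfloor> \<and> cell N1 4 = real r \<and>
    cell N1 5 = real q \<and> cell N1 6 = real d"
  let ?post = "\<lambda>N2. agree temp N N2 \<and> index_cell N2 3 = j' \<and>
    cell N2 4 = real r \<and> cell N2 7 = real x \<and> cell N2 6 = real d"
  let ?prog1 = "[Instr (Floor 3 (loc k b))] @ [Instr (Floor 4 (loc k c)),
    IfLe 4 10 [Instr (Const 4 0)] []] @ [Instr (Const 6 (real d)), Instr (Arith Div 5 4 6),
    Instr (Floor 5 5), Instr (Arith Mul 7 5 6), Instr (Arith Sub 4 4 7)]"
  let ?prog2 = "[IfLe 3 1 (redirect k @ table 0 (A k)) (table 0 (B k))]"
  let ?prog3 = "[Instr (Arith Mul 7 7 6), Instr (Arith Add 7 7 4), Instr (Get (loc k a) 3 7)]"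
  have 1: "triple I ?prog1 N (1 + (3 + 5)) ?pre"
  proof (rule triple_append)
    let ?N1 = "N(3 \<mapsto> real_of_int \<lfloor>cell N (loc k b)\<rfloor>)"
    show "triple I [Instr (Floor 3 (loc k b))] N 1 (\<lambda>N1. N1 = ?N1)" by simp
    fix N1 assume "N1 = ?N1"
    then have N1: "agree temp N N1" "index_cell N1 3 = j" "index_cell N1 (loc k c) = e"
      "cell N1 3 = real_of_int \<lfloor>cell N (loc k b)\<rfloor>" "cell N1 10 = 0"
      using low by (simp_all add: low_def j_def e_def index_cell_loc[symmetric]) (simp add: index_cell_def)
    show "triple I ([Instr (Floor 4 (loc k c)),
      IfLe 4 10 [Instr (Const 4 0)] []] @ [Instr (Const 6 (real d)), Instr (Arith Div 5 4 6),
      Instr (Floor 5 5), Instr (Arith Mul 7 5 6), Instr (Arith Sub 4 4 7)]) N1 (3 + 5) ?pre"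
    proof (rule triple_append[OF triple_clip[OF N1(5)]])
      fix N2 assume N2: "agree {4} N1 N2 \<and> cell N2 4 = real (index_cell N1 (loc k c))"
      have "agree temp N N2" "index_cell N2 3 = j" "cell N2 4 = real e"
        "cell N2 3 = real_of_int \<lfloor>cell N (loc k b)\<rfloor>"
        using N1 N2 agree_cell[of "{4}" N1 N2 3] agree_mono[of "{4}" N1 N2 temp]
        by (auto simp: index_cell_def intro!: agree_trans[of temp N N1 N2])
      moreover have "real e - real q * real d = real r"
        unfolding q_def r_def by (metis add_diff_cancel_left' div_mult_mod_eq of_nat_add of_nat_mult)
      ultimately show "triple I [Instr (Const 6 (real d)), Instr (Arith Div 5 4 6),
        Instr (Floor 5 5), Instr (Arith Mul 7 5 6), Instr (Arith Sub 4 4 7)] N2 5 ?pre"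
        by (simp add: floor_divide_of_nat_eq q_def)
    qed simp
  qed
  have 2: "triple I ?prog2 N1
    (1 + (5 + (2 * L + 1))) ?post" if N1: "?pre N1" for N1
  proof -
    \<comment> \<open>The cell may hold a negative integer, which \<open>index_cell\<close> reads as
      0; because of \<open>0 < n\<close> the comparison with \<open>n - 1\<close> is right in that
      case too.\<close>
    have le: "cell N1 3 \<le> cell N1 1 \<longleftrightarrow> j < n"
    proof -
      have "cell N1 1 = real n - 1"
        using low N1 agree_cell[of temp N N1 1] by (simp add: low_def)
      moreover have "j = nat \<lfloor>cell N (loc k b)\<rfloor>"
        by (simp add: j_def index_cell_def cell_loc)
      ultimately show ?thesis using N1 n by linarith
    qed
    have table: "triple I (table 0 xs) N2 (2 * L + 1) ?post"
      if N2: "agree temp N N2" "index_cell N2 3 = j'" "cell N2 4 = real r"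
          "cell N2 5 = real q" "cell N2 6 = real d"
        and xs: "length xs = L" "nth_default m xs q = x" for N2 xs
    proof -
      have "triple I (table 0 xs) N2 (2 * length xs + 1)
        (\<lambda>N3. agree {7} N2 N3 \<and> cell N3 7 = real (nth_default m xs (q - 0)))"
        using N2(4) by (rule triple_table) simp
      then show ?thesis
      proof (rule triple_conseq)
        fix N3 assume N3: "agree {7} N2 N3 \<and> cell N3 7 = real (nth_default m xs (q - 0))"
        have same: "cell N3 s = cell N2 s" if "s \<noteq> 7" for s
          using N3 that agree_cell[of "{7}" N2 N3 s] by simp
        have "agree temp N2 N3" using N3 by (auto intro: agree_mono)
        then have "agree temp N N3" using N2(1) by (rule agree_trans[rotated])
        then show "?post N3" using N2 xs(2) N3 same[of 3] same[of 4] same[of 6]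
          by (simp add: index_cell_def)
      qed (simp add: xs)
    qed
    have N1': "agree temp N N1" "index_cell N1 3 = j" "cell N1 4 = real r"
      "cell N1 5 = real q" "cell N1 6 = real d" using N1 by blast+
    show ?thesis
    proof (cases "j < n")
      case True
      have low1: "low n \<rho> N1"
      proof (rule low_agree[OF low])
        show "agree temp N N1" by (rule N1')
      qed (simp add: disjoint_iff)
      have "triple I (redirect k @ table 0 (A k)) N1 (5 + (2 * L + 1)) ?post"
      proof (rule triple_append[OF triple_redirect[OF k low1]])
        fix N2 assume N2: "agree ?T N1 N2 \<and> index_cell N2 3 = redirected k \<rho> I (index_cell N1 3)"
        have same: "cell N2 s = cell N1 s" if "s \<notin> ?T" for s
          using N2 that agree_cell[of ?T N1 N2 s] by simp
        have "agree temp N1 N2" using N2 by (auto intro: agree_mono)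
        then have "agree temp N N2" using N1'(1) by (rule agree_trans[rotated])
        then show "triple I (table 0 (A k)) N2 (2 * L + 1) ?post"
          by (rule table)
            (use N1' N2 True same[of 4] same[of 5] same[of 6] length_A[OF k]
              in \<open>simp_all add: j'_def x_def\<close>)
      qed
      then show ?thesis
        by (intro triple_IfLe_single) (simp only: le True if_True)
    next
      case False
      have "triple I (table 0 (B k)) N1 (2 * L + 1) ?post"
        by (rule table) (use N1' False length_B[OF k] in \<open>simp_all add: j'_def x_def\<close>)
      then have "triple I (table 0 (B k)) N1 (5 + (2 * L + 1)) ?post"
        by (rule triple_conseq) simp_all
      then show ?thesis
        by (intro triple_IfLe_single) (simp only: le False if_False)
    qed
  qed
  have 3: "triple I ?prog3 N2 3
    (\<lambda>N'. agree (temp \<union> range (loc k)) N N' \<and> part k N' = (part k N)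
       (a \<mapsto> entry (object I' j) e))" if N2: "?post N2" for N2
  proof -
    have N2': "agree temp N N2" using N2 by blast
    then have "part k N2 = part k N"
      by (rule agree_loc) (simp add: loc_def)
    moreover have "real x * real d + real r = real (x * d + r)" by simp
    moreover have "entry (object I' j) e = entry (object I j') (x * d + r)"
      using view by (simp add: view_def j'_def x_def q_def r_def)
    moreover have "agree (temp \<union> range (loc k)) N N2"
      using N2' by (rule agree_mono) simp
    moreover have "index_cell N2 3 = j'" "cell N2 7 = real x" "cell N2 6 = real d" "cell N2 4 = real r"
      using N2 by blast+
    ultimately show ?thesis using k by (simp del: of_nat_add of_nat_mult)
  qed
  have "triple I (?prog1 @ ?prog2 @ ?prog3) N ((1 + (3 + 5)) + ((1 + (5 + (2 * L + 1))) + 3))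
    (\<lambda>N'. agree (temp \<union> range (loc k)) N N' \<and> part k N' = (part k N)(a \<mapsto> entry (object I' j) e))"
  proof (rule triple_append[OF 1])
    fix N1 assume "?pre N1"
    then show "triple I (?prog2 @ ?prog3) N1 ((1 + (5 + (2 * L + 1))) + 3)
      (\<lambda>N'. agree (temp \<union> range (loc k)) N N' \<and> part k N' = (part k N)(a \<mapsto> entry (object I' j) e))"
      by (rule triple_append[OF 2 3])
  qed
  moreover have "?prog1 @ ?prog2 @ ?prog3 = compile_instr k (Get a b c)" by simp
  moreover have "(1 + (3 + 5)) + ((1 + (5 + (2 * L + 1))) + 3) = 19 + 2 * L" by simp
  ultimately show ?thesis by (simp only: j_def e_def)
qed

lemma couples_compile_instr:
  assumes k: "k < K" and low: "low n \<rho> N" and view: "view k n \<rho> I' I" and n: "0 < n" and L: "0 < L"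
  shows "couples (exec I' i (part k N)) I (compile_instr k i) N (19 + 2 * L)
    (\<lambda>M' N'. agree (temp \<union> range (loc k)) N N' \<and> part k N' = M')"
proof -
  have zero: "cell N 10 = 0" using low by (simp add: low_def)
  have agree_address: "agree (temp \<union> range (loc k)) N (N(4 \<mapsto> y, 3 \<mapsto> z))" for y z by simp
  show ?thesis
  proof (cases i)
    case (Load a b)
    have "triple I (compile_instr k i) N (7 + 1) (\<lambda>N'. agree (temp \<union> range (loc k)) N N' \<and>
      part k N' = (part k N)(a \<mapsto> cell (part k N) (index_cell (part k N) b)))"
      unfolding Load compile_instr.simps
    proof (rule triple_append[OF triple_address[OF zero]])
      fix N' assume N': "agree {3, 4} N N' \<and> index_cell N' 3 = loc k (index_cell (part k N) b)"
      then have "part k N' = part k N" "agree (temp \<union> range (loc k)) N N'"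
        by (auto intro: agree_loc agree_mono)
      then show "triple I [Instr (Load (loc k a) 3)] N' 1 (\<lambda>N'. agree (temp \<union> range (loc k)) N N' \<and>
        part k N' = (part k N)(a \<mapsto> cell (part k N) (index_cell (part k N) b)))"
        using k N' by (simp add: cell_loc)
    qed
    then show ?thesis
      by (simp only: Load exec.simps couples_return) (erule triple_conseq; use L in auto)
  next
    case (Store a b)
    have "triple I (compile_instr k i) N (7 + 1) (\<lambda>N'. agree (temp \<union> range (loc k)) N N' \<and>
      part k N' = (part k N)(index_cell (part k N) a \<mapsto> cell (part k N) b))"
      unfolding Store compile_instr.simps
    proof (rule triple_append[OF triple_address[OF zero]])
      fix N' assume N': "agree {3, 4} N N' \<and> index_cell N' 3 = loc k (index_cell (part k N) a)"
      then have "part k N' = part k N" "agree (temp \<union> range (loc k)) N N'"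
        by (auto intro: agree_loc agree_mono)
      then show "triple I [Instr (Store 3 (loc k b))] N' 1 (\<lambda>N'. agree (temp \<union> range (loc k)) N N' \<and>
        part k N' = (part k N)(index_cell (part k N) a \<mapsto> cell (part k N) b))"
        using k N' by (simp add: cell_loc)
    qed
    then show ?thesis
      by (simp only: Store exec.simps couples_return) (erule triple_conseq; use L in auto)
  next
    case (Sample a D)
    have "steps I (19 + 2 * L) (compile_instr k i, N)
      = map_pmf (\<lambda>x. ([], N(loc k a \<mapsto> x))) D"
      by (simp add: Sample numeral_eq_Suc map_pmf_comp o_def bind_map_pmf map_pmf_def[symmetric])
    \<comment> \<open>Both sides draw from the same \<open>D\<close>, and the coupling identifies
      the two draws.\<close>
    moreover have "rel_pmf (\<lambda>M c. fst c = [] \<and> agree (temp \<union> range (loc k)) N (snd c) \<and> part k (snd c) = M)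
      (map_pmf (\<lambda>x. (part k N)(a \<mapsto> x)) D) (map_pmf (\<lambda>x. ([], N(loc k a \<mapsto> x))) D)"
      unfolding pmf.rel_map by (rule pmf.rel_refl) (use k in simp)
    ultimately show ?thesis by (simp add: couples_def Sample)
  next
    case (Get a b c)
    then show ?thesis using triple_Get[OF k low view n] by (simp add: couples_return)
  next
    case (Size a b)
    have "triple I (compile_instr k i) N 3 (\<lambda>N'. agree (temp \<union> range (loc k)) N N' \<and> part k N' =
        (part k N)(a \<mapsto> real (length (object I' (index_cell (part k N) b)))))"
      using view zero k by (auto simp: Size view_def index_cell_loc)
    then show ?thesis
      by (simp only: Size exec.simps couples_return) (erule triple_conseq; use L in auto)
  qed (use view k in \<open>auto simp: couples_return numeral_eq_Suc view_def cell_loc\<close>)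
qed

section \<open>Simulation of whole runs\<close>

lemma halts_within_0: "halts_within I P M 0 \<longleftrightarrow> P = []"
  by (simp add: halts_within_def)

lemma halts_within_Suc:
  "halts_within I P M (Suc t) \<longleftrightarrow> (\<forall>c \<in> set_pmf (step I (P, M)). halts_within I (fst c) (snd c) t)"
  by (auto simp: halts_within_def set_bind_pmf)

lemma memory_after_Suc:
  "memory_after I P M (Suc t) = bind_pmf (step I (P, M)) (\<lambda>c. memory_after I (fst c) (snd c) t)"
  by (simp add: memory_after_def map_bind_pmf)

text \<open>Induction on the running time of the simulated program, because a loop reappears after
  unfolding. Only \<open>temp\<close> and the copy's own cells change, which lets the copies run one
  after another.\<close>

lemma couples_compile:
  assumes k: "k < K" and view: "view k n \<rho> I' I" and n: "0 < n" and L: "0 < L"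
    and low: "low n \<rho> N" and halts: "halts_within I' P (part k N) t"
  shows "couples (memory_after I' P (part k N) t) I (compile k P) N ((19 + 2 * L) * t)
    (\<lambda>M' N'. agree (temp \<union> range (loc k)) N N' \<and> part k N' = M')"
  using low halts
proof (induction t arbitrary: P N)
  case 0
  then show ?case by (simp add: halts_within_0 memory_after_def couples_return)
next
  case (Suc t)
  let ?U = "temp \<union> range (loc k)" and ?c = "19 + 2 * L"
  show ?case
  proof (cases P)
    case Nil
    then show ?thesis by (simp add: memory_after_def couples_return bind_return_pmf)
  next
    case (Cons s P')
    \<comment> \<open>Conditionals and loops take one step on either side and leave the memory
      alone. As compilation distributes over appending, an unfolded loop compiles to the unfolding
      of the compiled loop.\<close>
    have branch: "couples (memory_after I' P (part k N) (Suc t)) I (compile k P) N (?c * Suc t)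
      (\<lambda>M' N'. agree ?U N N' \<and> part k N' = M')"
      if "step I' (P, part k N) = return_pmf (P1, part k N)"
        "step I (compile k P, N) = return_pmf (compile k P1, N)" for P1
    proof -
      have "halts_within I' P1 (part k N) t" using Suc.prems that by (simp add: halts_within_Suc)
      from Suc.IH[OF Suc.prems(1) this] have "couples (memory_after I' P1 (part k N) t) I
        (compile k P) N (Suc (?c * t)) (\<lambda>M' N'. agree ?U N N' \<and> part k N' = M')"
        using that by (simp add: couples_def bind_return_pmf)
      then have "couples (memory_after I' P1 (part k N) t) I
        (compile k P) N (?c * Suc t) (\<lambda>M' N'. agree ?U N N' \<and> part k N' = M')"
        by (rule couples_mono) auto
      then show ?thesis using that by (simp add: memory_after_Suc bind_return_pmf)
    qed
    show ?thesis
    proof (cases s)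
      case (Instr i)
      have "couples (bind_pmf (exec I' i (part k N)) (\<lambda>M. memory_after I' P' M t)) I
        (compile_instr k i @ compile k P') N (?c + ?c * t) (\<lambda>M' N'. agree ?U N N' \<and> part k N' = M')"
      proof (rule couples_append[OF couples_compile_instr[OF k Suc.prems(1) view n L]])
        fix M N1 assume M: "M \<in> set_pmf (exec I' i (part k N))"
          and N1: "agree ?U N N1 \<and> part k N1 = M"
        have "halts_within I' P' (part k N1) t"
          using Suc.prems(2) M N1 by (auto simp: Cons Instr halts_within_Suc)
        from Suc.IH[OF low_sim[OF Suc.prems(1), of k] this] N1
        show "couples (memory_after I' P' M t) I (compile k P') N1 (?c * t)
          (\<lambda>M' N'. agree ?U N N' \<and> part k N' = M')"
          by (auto elim!: couples_mono intro: agree_trans[of _ N N1])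
      qed
      then show ?thesis
        by (simp add: Cons Instr memory_after_Suc bind_map_pmf algebra_simps)
    next
      case (IfLe a b P1 P2)
      show ?thesis
        by (rule branch[of "(if cell (part k N) a \<le> cell (part k N) b then P1 else P2) @ P'"])
          (auto simp: Cons IfLe cell_loc)
    next
      case (WhileLe a b P1)
      show ?thesis
        by (rule branch[of "if cell (part k N) a \<le> cell (part k N) b then P1 @ P else P'"])
          (auto simp: Cons WhileLe cell_loc)
    qed
  qed
qed

section \<open>Preprocessing and queries for all structures at once\<close>

lemma low_agree_temp: "low n \<rho> N \<Longrightarrow> agree temp N N' \<Longrightarrow> low n \<rho> N'"
  by (erule low_agree) (auto simp: disjoint_iff)

lemma part_agree:
  assumes "agree (temp \<union> range (loc k)) N N'" "k < K" "k' < K" "k' \<noteq> k"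
  shows "part k' N' = part k' N"
proof (rule agree_loc[OF assms(1)])
  show "loc k' a \<notin> temp \<union> range (loc k)" for a
    using loc_ge[of k' a] assms by (auto simp: loc_inj)
qed

section \<open>Evaluating the candidate of one copy\<close>

definition coord_code :: "nat \<Rightarrow> nat \<Rightarrow> nat \<Rightarrow> prog" where
  "coord_code x y c = [Instr (Const 6 (real (x * d + c))), Instr (Get 6 3 6),
     Instr (Const 7 (real (y * d + c))), Instr (Get 7 9 7),
     Instr (Arith Sub 6 6 7), Instr (Arith Mul 6 6 6), Instr (Arith Add 5 5 6)]"

definition point_code :: "real \<Rightarrow> nat \<times> nat \<Rightarrow> prog" where
  "point_code p xy = (Instr (Const 5 0) # concat (map (coord_code (fst xy) (snd xy)) [0..<d])) @
     [Instr (Const 6 (p / 2)), Instr (Arith Pow 5 5 6), Instr (Arith Add 4 4 5)]"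

definition cost_code :: "real \<Rightarrow> nat \<Rightarrow> prog" where
  "cost_code p k = Instr (Const 4 0) # concat (map (point_code p) (zip (A k) (B k)))"

text \<open>Raising the squared norm to the power \<open>p / 2\<close> gives the \<open>p\<close>-th
  power of the norm without a root. Here \<open>u\<close> encodes the query and \<open>v\<close> the
  data curve; reads past the end act as the zero vector.\<close>

definition point_cost :: "real \<Rightarrow> real list \<Rightarrow> real list \<Rightarrow> nat \<times> nat \<Rightarrow> real" where
  "point_cost p u v xy =
     (\<Sum>c<d. (entry v (fst xy * d + c) - entry u (snd xy * d + c)) ^ 2) powr (p / 2)"

definition cost :: "real \<Rightarrow> nat \<Rightarrow> real list \<Rightarrow> real list \<Rightarrow> real" where
  "cost p k u v = (\<Sum>xy \<leftarrow> zip (A k) (B k). point_cost p u v xy)"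

lemma cost_nonneg: "0 \<le> cost p k u v"
  by (auto simp: cost_def point_cost_def intro!: sum_list_nonneg)

text \<open>Costs are unbounded, so no initial value could stand for the worst cost. The score
  \<open>1 / (1 + cost)\<close> is positive and decreases with the cost, and 0 can mean that nothing
  has been found yet.\<close>

definition update_code :: prog where
  "update_code = [Instr (Const 7 1), Instr (Arith Add 4 4 7), Instr (Arith Div 4 7 4),
     IfLe 2 4 [Instr (Floor 0 3), Instr (Const 7 0), Instr (Arith Add 2 4 7)] []]"

definition query_check :: "real \<Rightarrow> nat \<Rightarrow> prog" where
  "query_check p k = [Instr (Const 7 1), Instr (Arith Add 9 1 7), Instr (Size 7 9),
     Instr (Const 8 (real (F k * d))), IfLe 7 8 [IfLe 8 7 (cost_code p k @ update_code) []] []]"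

text \<open>A copy whose walk does not fit the query, or whose length \<open>E k\<close> no data
  curve has, may report anything. An answer counts only if it is the index of a data object and,
  after redirection, both lengths fit the walk; the computed cost then belongs to a genuine
  traversal.\<close>

definition evaluate :: "real \<Rightarrow> nat \<Rightarrow> prog" where
  "evaluate p k = [Instr (Floor 3 (loc k 0)), IfLe 3 1 (redirect k @
     [Instr (Size 7 3), Instr (Const 8 (real (E k * d))), IfLe 7 8 [IfLe 8 7 (query_check p k) []] []]) []]"

lemma triple_coords:
  "triple I (concat (map (coord_code x y) [0..<c])) N (7 * c)
    (\<lambda>N'. agree {5, 6, 7} N N' \<and> cell N' 5 = cell N 5 +
      (\<Sum>i<c. (entry (object I (index_cell N 3)) (x * d + i)
        - entry (object I (index_cell N 9)) (y * d + i)) ^ 2))"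
proof (induction c)
  case 0
  then show ?case by simp
next
  case (Suc c)
  have "triple I (concat (map (coord_code x y) [0..<c]) @ coord_code x y c) N (7 * c + 7)
    (\<lambda>N'. agree {5, 6, 7} N N' \<and> cell N' 5 = cell N 5 +
      (\<Sum>i<Suc c. (entry (object I (index_cell N 3)) (x * d + i)
        - entry (object I (index_cell N 9)) (y * d + i)) ^ 2))"
  proof (rule triple_append[OF Suc.IH], elim conjE)
    fix N1 assume N1: "agree {5, 6, 7} N N1" "cell N1 5 = cell N 5 +
      (\<Sum>i<c. (entry (object I (index_cell N 3)) (x * d + i)
        - entry (object I (index_cell N 9)) (y * d + i)) ^ 2)"
    have "index_cell N1 3 = index_cell N 3" "index_cell N1 9 = index_cell N 9"
      using agree_cell[OF N1(1)] by (simp_all add: index_cell_def)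
    then show "triple I (coord_code x y c) N1 7
      (\<lambda>N'. agree {5, 6, 7} N N' \<and> cell N' 5 = cell N 5 +
      (\<Sum>i<Suc c. (entry (object I (index_cell N 3)) (x * d + i)
        - entry (object I (index_cell N 9)) (y * d + i)) ^ 2))"
      using N1 by (simp add: coord_code_def power2_eq_square del: of_nat_add of_nat_mult)
  qed
  then show ?case by (simp add: add.commute)
qed

lemma triple_point:
  "triple I (point_code p xy) N (7 * d + 4)
    (\<lambda>N'. agree {4..7} N N' \<and> cell N' 4 = cell N 4 +
      point_cost p (object I (index_cell N 9)) (object I (index_cell N 3)) xy)"
proof -
  let ?x = "fst xy" and ?y = "snd xy"
  define s where "s = (\<Sum>i<d. (entry (object I (index_cell N 3)) (?x * d + i)
    - entry (object I (index_cell N 9)) (?y * d + i)) ^ 2)"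
  have "triple I (concat (map (coord_code ?x ?y) [0..<d])) (N(5 \<mapsto> 0)) (7 * d)
    (\<lambda>N'. agree {5, 6, 7} (N(5 \<mapsto> 0)) N' \<and> cell N' 5 = s)"
    using triple_coords[of I ?x ?y d "N(5 \<mapsto> 0)"] by (simp add: s_def)
  then have "triple I (Instr (Const 5 0) # concat (map (coord_code ?x ?y) [0..<d])) N (Suc (7 * d))
    (\<lambda>N'. agree {5, 6, 7} (N(5 \<mapsto> 0)) N' \<and> cell N' 5 = s)" by simp
  then have "triple I (point_code p xy) N (Suc (7 * d) + 3)
    (\<lambda>N'. agree {4..7} N N' \<and> cell N' 4 = cell N 4 + s powr (p / 2))"
    unfolding point_code_def
  proof (rule triple_append, elim conjE)
    fix N1 assume N1: "agree {5, 6, 7} (N(5 \<mapsto> 0)) N1" "cell N1 5 = s"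
    have "agree {4..7} N (N(5 \<mapsto> 0))" by simp
    moreover have "agree {4..7} (N(5 \<mapsto> 0)) N1" using N1(1) by (rule agree_mono) simp
    ultimately have "agree {4..7} N N1" by (rule agree_trans)
    moreover have "cell N1 4 = cell N 4" using agree_cell[OF N1(1), of 4] by simp
    ultimately show "triple I [Instr (Const 6 (p / 2)), Instr (Arith Pow 5 5 6),
      Instr (Arith Add 4 4 5)] N1 3
      (\<lambda>N'. agree {4..7} N N' \<and> cell N' 4 = cell N 4 + s powr (p / 2))"
      using N1(2) by simp
  qed
  then show ?thesis by (rule triple_conseq) (simp_all add: s_def point_cost_def)
qed

lemma triple_points:
  "triple I (concat (map (point_code p) xys)) N (length xys * (7 * d + 4))
    (\<lambda>N'. agree {4..7} N N' \<and> cell N' 4 = cell N 4 +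
      (\<Sum>xy\<leftarrow>xys. point_cost p (object I (index_cell N 9)) (object I (index_cell N 3)) xy))"
proof (induction xys rule: rev_induct)
  case Nil
  then show ?case by simp
next
  case (snoc xy xys)
  have "triple I (concat (map (point_code p) xys) @ point_code p xy) N
    (length xys * (7 * d + 4) + (7 * d + 4))
    (\<lambda>N'. agree {4..7} N N' \<and> cell N' 4 = cell N 4 +
      (\<Sum>xy\<leftarrow>xys @ [xy]. point_cost p (object I (index_cell N 9)) (object I (index_cell N 3)) xy))"
  proof (rule triple_append[OF snoc.IH], elim conjE)
    fix N1 assume N1: "agree {4..7} N N1" "cell N1 4 = cell N 4 +
      (\<Sum>xy\<leftarrow>xys. point_cost p (object I (index_cell N 9)) (object I (index_cell N 3)) xy)"
    have *: "index_cell N1 3 = index_cell N 3" "index_cell N1 9 = index_cell N 9"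
      using agree_cell[OF N1(1)] by (simp_all add: index_cell_def)
    show "triple I (point_code p xy) N1 (7 * d + 4)
      (\<lambda>N'. agree {4..7} N N' \<and> cell N' 4 = cell N 4 +
      (\<Sum>xy\<leftarrow>xys @ [xy]. point_cost p (object I (index_cell N 9)) (object I (index_cell N 3)) xy))"
      using triple_point[of I p xy N1]
      by (rule triple_conseq) (use N1 * in \<open>auto intro: agree_trans[of _ N N1]\<close>)
  qed
  then show ?case by (simp add: algebra_simps)
qed

lemma triple_cost:
  assumes "k < K"
  shows "triple I (cost_code p k) N (1 + L * (7 * d + 4))
    (\<lambda>N'. agree {4..7} N N' \<and>
      cell N' 4 = cost p k (object I (index_cell N 9)) (object I (index_cell N 3)))"
proof -
  have "triple I (concat (map (point_code p) (zip (A k) (B k)))) (N(4 \<mapsto> 0)) (L * (7 * d + 4))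
    (\<lambda>N'. agree {4..7} (N(4 \<mapsto> 0)) N' \<and>
      cell N' 4 = cost p k (object I (index_cell N 9)) (object I (index_cell N 3)))"
    using triple_points[of I p "zip (A k) (B k)" "N(4 \<mapsto> 0)"] length_A[OF assms] length_B[OF assms]
    by (simp add: cost_def)
  then have "triple I (cost_code p k) N (1 + L * (7 * d + 4))
    (\<lambda>N'. agree {4..7} (N(4 \<mapsto> 0)) N' \<and>
      cell N' 4 = cost p k (object I (index_cell N 9)) (object I (index_cell N 3)))"
    by (simp add: cost_code_def)
  then show ?thesis
    by (rule triple_conseq) (auto intro: agree_trans[of _ N "N(4 \<mapsto> 0)"])
qed

definition score :: "real \<Rightarrow> nat \<Rightarrow> nat \<Rightarrow> real list list \<Rightarrow> nat \<Rightarrow> real" where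
  "score p k n I j = 1 / (1 + cost p k (object I n) (object I j))"

lemma score_pos: "0 < score p k n I j"
  using cost_nonneg[of p k "object I n" "object I j"] by (simp add: score_def add_pos_nonneg)

definition candidate :: "nat \<Rightarrow> nat \<Rightarrow> real list list \<Rightarrow> nat \<Rightarrow> bool" where
  "candidate k n I j \<longleftrightarrow>
     j < n \<and> length (object I j) = E k * d \<and> length (object I n) = F k * d"

definition improved :: "real \<Rightarrow> nat \<Rightarrow> nat \<Rightarrow> real list list \<Rightarrow> nat \<Rightarrow> mem \<Rightarrow> mem \<Rightarrow> bool" where
  "improved p k n I j N N' \<longleftrightarrow> agree ({0, 2} \<union> temp) N N' \<and>
     (if candidate k n I j \<and> cell N 2 \<le> score p k n I j
      then cell N' 2 = score p k n I j \<and> index_cell N' 0 = j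
      else cell N' 2 = cell N 2 \<and> index_cell N' 0 = index_cell N 0)"

lemma triple_update:
  assumes "cell N 4 = cost p k (object I n) (object I j)" "index_cell N 3 = j" "candidate k n I j"
    and "agree temp N0 N"
  shows "triple I update_code N 7 (improved p k n I j N0)"
proof -
  have "cell N 2 = cell N0 2" "index_cell N 0 = index_cell N0 0"
    using agree_cell[OF assms(4)] by (simp_all add: index_cell_def)
  moreover have "agree ({0, 2} \<union> temp) N0 N" using assms(4) by (rule agree_mono) auto
  moreover have "1 / (cell N 4 + 1) = score p k n I j" using assms(1)
    by (simp add: score_def add.commute)
  moreover have "nat \<lfloor>cell N 3\<rfloor> = j" using assms(2) by (simp add: index_cell_def)
  ultimately show ?thesis using assms(3) by (simp add: update_code_def improved_def)
qed

lemma improved_trivial: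
  assumes "\<not> candidate k n I j" "agree temp N N'"
  shows "improved p k n I j N N'"
proof -
  have "agree ({0, 2} \<union> temp) N N'" using assms(2) by (rule agree_mono) auto
  then show ?thesis
    using assms(1) agree_cell[OF assms(2)] by (simp add: improved_def index_cell_def)
qed

lemma triple_IfEq:
  assumes "cell N a = cell N b \<Longrightarrow> triple I P N t \<Phi>" "cell N a \<noteq> cell N b \<Longrightarrow> \<Phi> N"
  shows "triple I [IfLe a b [IfLe b a P []] []] N (2 + t) \<Phi>"
  using assms by (cases "cell N a = cell N b") auto

lemma triple_query_check:
  assumes k: "k < K" and low: "low n \<rho> N" and j: "index_cell N 3 = j" "j < n"
    "length (object I j) = E k * d" and "agree temp N0 N"
  shows "triple I (query_check p k) N (4 + (2 + (1 + L * (7 * d + 4) + 7))) (improved p k n I j N0)"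
proof -
  define N1 where "N1 = N(7 \<mapsto> real (length (object I n)), 9 \<mapsto> real n, 8 \<mapsto> real (F k * d))"
  have agree1: "agree temp N0 N1" using assms(6) by (simp add: N1_def)
  have cells: "index_cell N1 3 = j" "index_cell N1 9 = n"
    "cell N1 7 = cell N1 8 \<longleftrightarrow> length (object I n) = F k * d"
    using j by (simp_all add: N1_def del: of_nat_mult)
  have "triple I [Instr (Const 7 1), Instr (Arith Add 9 1 7), Instr (Size 7 9),
     Instr (Const 8 (real (F k * d)))] N 4 (\<lambda>N'. N' = N1)"
    using low by (simp add: low_def N1_def fun_upd_twist)
  moreover have "triple I [IfLe 7 8 [IfLe 8 7 (cost_code p k @ update_code) []] []] N1
    (2 + (1 + L * (7 * d + 4) + 7)) (improved p k n I j N0)"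
  proof (rule triple_IfEq)
    assume eq: "cell N1 7 = cell N1 8"
    show "triple I (cost_code p k @ update_code) N1 (1 + L * (7 * d + 4) + 7) (improved p k n I j N0)"
    proof (rule triple_append[OF triple_cost[OF k]], elim conjE)
      fix N2 assume N2: "agree {4..7} N1 N2"
        "cell N2 4 = cost p k (object I (index_cell N1 9)) (object I (index_cell N1 3))"
      have "agree temp N1 N2" using N2(1) by (rule agree_mono) simp
      with agree1 have "agree temp N0 N2" by (rule agree_trans)
      moreover have "index_cell N2 3 = j"
        using agree_cell[OF N2(1), of 3] cells by (simp add: index_cell_def)
      moreover have "candidate k n I j" using j eq cells by (simp add: candidate_def)
      ultimately show "triple I update_code N2 7 (improved p k n I j N0)"
        using triple_update N2(2) cells by simp
    qed
  next
    assume "cell N1 7 \<noteq> cell N1 8"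
    then show "improved p k n I j N0 N1"
      using improved_trivial[OF _ agree1] cells by (simp add: candidate_def)
  qed
  ultimately have "triple I ([Instr (Const 7 1), Instr (Arith Add 9 1 7), Instr (Size 7 9),
      Instr (Const 8 (real (F k * d)))] @ [IfLe 7 8 [IfLe 8 7 (cost_code p k @ update_code) []] []]) N
    (4 + (2 + (1 + L * (7 * d + 4) + 7))) (improved p k n I j N0)"
    by (intro triple_append) simp_all
  then show ?thesis by (simp only: query_check_def append.simps)
qed

lemma triple_evaluate:
  assumes k: "k < K" and low: "low n \<rho> N" and n: "0 < n" and \<rho>: "\<forall>i \<in> {1..m}. \<rho> i < n"
    and j: "j = index_cell (part k N) 0"
  shows "triple I (evaluate p k) N (25 + L * (7 * d + 4)) (\<lambda>N'.
    if j < n then improved p k n I (redirected k \<rho> I j) N N' else agree temp N N')"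
proof -
  let ?post = "\<lambda>N'. if j < n then improved p k n I (redirected k \<rho> I j) N N' else agree temp N N'"
  let ?J = "redirected k \<rho> I j" and ?t = "4 + (2 + (1 + L * (7 * d + 4) + 7))"
  let ?check = "[Instr (Size 7 3), Instr (Const 8 (real (E k * d)))] @
    [IfLe 7 8 [IfLe 8 7 (query_check p k) []] []]"
  define N1 where "N1 = N(3 \<mapsto> real_of_int \<lfloor>cell N (loc k 0)\<rfloor>)"
  have N1: "agree temp N N1" "index_cell N1 3 = j"
    by (simp_all add: N1_def j index_cell_def cell_loc)
  have "cell N (Suc 0) = real n - 1" using low by (simp add: low_def)
  then have le: "cell N1 3 \<le> cell N1 1 \<longleftrightarrow> j < n"
    using n by (simp add: N1_def j index_cell_def cell_loc[symmetric]) linarith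
  have low1: "low n \<rho> N1" using low N1(1) by (rule low_agree_temp)
  have "triple I (redirect k @ ?check) N1 (5 + (2 + (2 + ?t))) ?post" if "j < n"
  proof (rule triple_append[OF triple_redirect[OF k low1]], elim conjE)
    fix N2 assume N2: "agree {3, 7, 8} N1 N2" "index_cell N2 3 = redirected k \<rho> I (index_cell N1 3)"
    define N3 where "N3 = N2(7 \<mapsto> real (length (object I ?J)), 8 \<mapsto> real (E k * d))"
    have J: "index_cell N2 3 = ?J" using N2(2) N1(2) by simp
    have J_less: "?J < n" using that \<rho> E_bounds[OF k] by (simp add: redirected_def)
    have "agree temp N1 N2" using N2(1) by (rule agree_mono) simp
    with N1(1) have "agree temp N N2" by (rule agree_trans)
    then have agree3: "agree temp N N3" by (simp add: N3_def)
    have low3: "low n \<rho> N3"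
      using low agree3 by (rule low_agree_temp)
    have eq: "cell N3 7 = cell N3 8 \<longleftrightarrow> length (object I ?J) = E k * d"
      by (simp add: N3_def del: of_nat_mult)
    have "triple I [Instr (Size 7 3), Instr (Const 8 (real (E k * d)))] N2 2 (\<lambda>N'. N' = N3)"
      using J by (simp add: N3_def)
    moreover have "triple I [IfLe 7 8 [IfLe 8 7 (query_check p k) []] []] N3 (2 + ?t) ?post"
    proof (rule triple_IfEq)
      assume "cell N3 7 = cell N3 8"
      moreover have "index_cell N3 3 = ?J" using J by (simp add: N3_def)
      ultimately show "triple I (query_check p k) N3 ?t ?post"
        using triple_query_check[OF k low3 _ J_less _ agree3, of I p] eq that by simp
    next
      assume "cell N3 7 \<noteq> cell N3 8"
      then have "\<not> candidate k n I ?J" using eq by (simp add: candidate_def)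
      then show "?post N3" using improved_trivial[OF _ agree3] that by simp
    qed
    ultimately show "triple I ?check N2 (2 + (2 + ?t)) ?post"
      by (intro triple_append) simp_all
  qed
  then have "triple I [IfLe 3 1 (redirect k @ ?check) []] N1 (1 + (5 + (2 + (2 + ?t)))) ?post"
    using le N1 by (intro triple_IfLe_single) simp
  then have "triple I ([Instr (Floor 3 (loc k 0))] @ [IfLe 3 1 (redirect k @ ?check) []]) N
    (1 + (1 + (5 + (2 + (2 + ?t))))) ?post"
    by (intro triple_append[of I _ N 1 "\<lambda>N'. N' = N1"]) (simp_all add: N1_def)
  then show ?thesis
    unfolding evaluate_def by (simp only: append.simps) (erule triple_conseq; simp)
qed

section \<open>The query program and its invariants\<close>

definition query_block :: "real \<Rightarrow> prog \<Rightarrow> nat \<Rightarrow> prog" where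
  "query_block p query k = compile k query @ evaluate p k"

definition query_prog :: "real \<Rightarrow> prog \<Rightarrow> prog" where
  "query_prog p query = Instr (Const 2 0) # concat (map (query_block p query) [0..<K])"

text \<open>The sound half of the invariant, valid on every outcome: whatever is recorded comes from
  an accepted candidate of some walk.\<close>

definition best :: "real \<Rightarrow> nat \<Rightarrow> real list list \<Rightarrow> mem \<Rightarrow> bool" where
  "best p n I N \<longleftrightarrow> cell N 2 = 0 \<or>
     (\<exists>k<K. candidate k n I (index_cell N 0) \<and> cell N 2 = score p k n I (index_cell N 0))"

text \<open>The other half, for one copy whose simulated memory is \<open>M\<close>: its candidate
  has been taken into account. As cell 2 never decreases from block to block, later copies cannot
  destroy this.\<close>

definition dominated ::
  "real \<Rightarrow> nat \<Rightarrow> (nat \<Rightarrow> nat) \<Rightarrow> real list list \<Rightarrow> nat \<Rightarrow> mem \<Rightarrow> mem \<Rightarrow> bool" where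
  "dominated p n \<rho> I k M N \<longleftrightarrow>
     (let j = index_cell M 0; J = redirected k \<rho> I j in
        j < n \<longrightarrow> candidate k n I J \<longrightarrow> score p k n I J \<le> cell N 2)"

lemma couples_query_block:
  assumes k: "k < K" and low: "low n \<rho> N" and n: "0 < n" and \<rho>: "\<forall>i \<in> {1..m}. \<rho> i < n"
    and L: "0 < L" and view: "view k n \<rho> I' I" and best: "best p n I N"
    and halts: "halts_within I' query (part k N) u"
  shows "couples (memory_after I' query (part k N) u) I (query_block p query k) N
    ((19 + 2 * L) * u + (25 + L * (7 * d + 4)))
    (\<lambda>M N'. low n \<rho> N' \<and> (\<forall>k' < K. k' \<noteq> k \<longrightarrow> part k' N' = part k' N) \<and>
      best p n I N' \<and> cell N 2 \<le> cell N' 2 \<and> dominated p n \<rho> I k M N')"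
    (is "couples ?\<mu> I _ N _ ?R")
proof -
  let ?U = "temp \<union> range (loc k)"
  have "couples (bind_pmf ?\<mu> return_pmf) I (compile k query @ evaluate p k) N
    ((19 + 2 * L) * u + (25 + L * (7 * d + 4))) ?R"
  proof (rule couples_append[OF couples_compile[OF k view n L low halts]], elim conjE)
    fix M N1 assume N1: "agree ?U N N1" "part k N1 = M"
    have low1: "low n \<rho> N1" using low N1(1) by (rule low_sim)
    have cells: "cell N1 2 = cell N 2" "index_cell N1 0 = index_cell N 0"
      using agree_cell[OF N1(1)] by (auto simp: index_cell_def image_iff)
    have parts: "part k' N1 = part k' N" if "k' < K" "k' \<noteq> k" for k'
      using N1(1) k that by (rule part_agree)
    let ?j = "index_cell M 0"
    let ?J = "redirected k \<rho> I ?j"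
    have "triple I (evaluate p k) N1 (25 + L * (7 * d + 4)) (\<lambda>N'.
      if ?j < n then improved p k n I ?J N1 N' else agree temp N1 N')"
      using triple_evaluate[OF k low1 n \<rho>] N1(2) by simp
    then have "triple I (evaluate p k) N1 (25 + L * (7 * d + 4)) (?R M)"
    proof (rule triple_conseq)
      fix N2 assume N2: "if ?j < n then improved p k n I ?J N1 N2 else agree temp N1 N2"
      have agree: "agree ({0, 2} \<union> temp) N1 N2"
      proof (cases "?j < n")
        case True
        then show ?thesis using N2 by (simp add: improved_def)
      next
        case False
        then have "agree temp N1 N2" using N2 by simp
        then show ?thesis by (rule agree_mono) auto
      qed
      have "part k' N2 = part k' N1" if "k' < K" for k'
        by (rule agree_loc[OF agree]) (auto simp: loc_def)
      moreover have "low n \<rho> N2"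
        by (rule low_agree[OF low1 agree]) (simp add: disjoint_iff)
      moreover have "best p n I N2 \<and> cell N1 2 \<le> cell N2 2 \<and> dominated p n \<rho> I k M N2"
      proof (cases "?j < n")
        case True
        then have "improved p k n I ?J N1 N2" using N2 by simp
        then show ?thesis
          using best cells k by (auto simp: improved_def best_def dominated_def Let_def split: if_splits)
      next
        case False
        then have "agree temp N1 N2" using N2 by simp
        then have "cell N2 2 = cell N1 2" "index_cell N2 0 = index_cell N1 0"
          using agree_cell[of temp N1 N2] by (auto simp: index_cell_def)
        then show ?thesis using False best cells by (simp add: best_def dominated_def Let_def)
      qed
      ultimately show "?R M N2" using parts cells by simp
    qed simp
    then show "couples (return_pmf M) I (evaluate p k) N1 (25 + L * (7 * d + 4)) ?R"
      by (simp add: couples_return)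
  qed
  then show ?thesis by (simp add: query_block_def bind_return_pmf')
qed

text \<open>Only the law of copy \<open>h\<close> is followed. The remaining copies share the run,
  but all that is used of them holds on every outcome.\<close>

lemma couples_query_prog:
  assumes low: "low n \<rho> N" and n: "0 < n" and \<rho>: "\<forall>i \<in> {1..m}. \<rho> i < n"
    and L: "0 < L" and view: "\<And>k. k < K \<Longrightarrow> view k n \<rho> (I' k) I"
    and halts: "\<And>k. k < K \<Longrightarrow> halts_within (I' k) query (part k N) (u k)" and h: "h < K"
  shows "couples (memory_after (I' h) query (part h N) (u h)) I (query_prog p query) N
    (1 + (\<Sum>k<K. (19 + 2 * L) * u k + (25 + L * (7 * d + 4))))
    (\<lambda>M N'. best p n I N' \<and> dominated p n \<rho> I h M N')"
proof -
  define \<mu> where "\<mu> = memory_after (I' h) query (part h N) (u h)"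
  let ?t = "\<lambda>k. (19 + 2 * L) * u k + (25 + L * (7 * d + 4))"
  define N0 where "N0 = N(2 \<mapsto> 0)"
  let ?R = "\<lambda>i M N'. low n \<rho> N' \<and> (\<forall>k. i \<le> k \<longrightarrow> k < K \<longrightarrow> part k N' = part k N) \<and>
    best p n I N' \<and> (h < i \<longrightarrow> dominated p n \<rho> I h M N')"
  \<comment> \<open>Before block \<open>h\<close> the coupled law is the point mass at the untouched
    memory of copy \<open>h\<close>; that block turns it into \<open>\<mu>\<close>, and later blocks
    leave it as it is.\<close>
  have "couples (if h < i then \<mu> else return_pmf (part h N)) I
    (concat (map (query_block p query) [0..<i])) N0 (\<Sum>k<i. ?t k) (?R i)" if "i \<le> K" for i
    using that
  proof (induction i)
    case 0
    have "low n \<rho> N0"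
    proof (rule low_agree[OF low])
      show "agree {2} N N0" by (simp add: N0_def)
    qed simp
    moreover have "part k N0 = part k N" for k by (simp add: N0_def)
    moreover have "best p n I N0" by (simp add: N0_def best_def)
    ultimately show ?case by (simp add: couples_return)
  next
    case (Suc i)
    then have i: "i < K" and IH: "couples (if h < i then \<mu> else return_pmf (part h N)) I
      (concat (map (query_block p query) [0..<i])) N0 (\<Sum>k<i. ?t k) (?R i)" by simp_all
    let ?\<mu> = "\<lambda>k. memory_after (I' k) query (part k N) (u k)"
    have block: "couples (?\<mu> i) I (query_block p query i) N1 (?t i)
      (\<lambda>M N'. low n \<rho> N' \<and> (\<forall>k < K. k \<noteq> i \<longrightarrow> part k N' = part k N1) \<and>
        best p n I N' \<and> cell N1 2 \<le> cell N' 2 \<and> dominated p n \<rho> I i M N')"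
      if "?R i M N1" for M N1
    proof -
      have N1: "low n \<rho> N1" "best p n I N1" "part i N1 = part i N" using that i by auto
      have "halts_within (I' i) query (part i N1) (u i)" using halts[OF i] N1(3) by simp
      from couples_query_block[OF i N1(1) n \<rho> L view[OF i] N1(2) this]
      show ?thesis using N1(3) by simp
    qed
    have "couples (bind_pmf (if h < i then \<mu> else return_pmf (part h N))
        (\<lambda>M. if h = i then \<mu> else return_pmf M)) I
      (concat (map (query_block p query) [0..<i]) @ query_block p query i) N0
      ((\<Sum>k<i. ?t k) + ?t i) (?R (Suc i))"
    proof (rule couples_append[OF IH])
      fix M N1 assume R: "?R i M N1"
      show "couples (if h = i then \<mu> else return_pmf M) I (query_block p query i) N1 (?t i) (?R (Suc i))"
      proof (cases "h = i")
        case True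
        have "couples (?\<mu> i) I (query_block p query i) N1 (?t i) (?R (Suc i))"
          using block[OF R] by (rule couples_mono) (use R True in auto)
        then show ?thesis using True by (simp add: \<mu>_def)
      next
        case False
        \<comment> \<open>For another copy the coupling is weakened to its support:
          \<open>best\<close> and the growth of cell 2 hold whatever that copy computes.\<close>
        have "triple I (query_block p query i) N1 (?t i) (?R (Suc i) M)"
          using couples_support[OF block[OF R]]
        proof (rule triple_conseq)
          fix N' assume "\<exists>M' \<in> set_pmf (?\<mu> i). low n \<rho> N' \<and>
            (\<forall>k < K. k \<noteq> i \<longrightarrow> part k N' = part k N1) \<and>
            best p n I N' \<and> cell N1 2 \<le> cell N' 2 \<and> dominated p n \<rho> I i M' N'"
          then show "?R (Suc i) M N'" using R False
            by (fastforce simp: dominated_def Let_def)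
        qed simp
        then show ?thesis using False by (simp add: couples_return)
      qed
    qed
    moreover have "bind_pmf (if h < i then \<mu> else return_pmf (part h N))
        (\<lambda>M. if h = i then \<mu> else return_pmf M) = (if h < Suc i then \<mu> else return_pmf (part h N))"
      by (auto simp: bind_return_pmf bind_return_pmf')
    ultimately show ?case by simp
  qed
  from this[of K] h have "couples \<mu> I (concat (map (query_block p query) [0..<K])) N0 (\<Sum>k<K. ?t k) (?R K)"
    by simp
  moreover have "triple I [Instr (Const 2 0)] N 1 (\<lambda>N'. N' = N0)"
    by (simp add: N0_def)
  then have "couples (return_pmf ()) I [Instr (Const 2 0)] N 1 (\<lambda>_ N'. N' = N0)"
    by (simp only: couples_return)
  ultimately have "couples (bind_pmf (return_pmf ()) (\<lambda>_. \<mu>)) I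
    ([Instr (Const 2 0)] @ concat (map (query_block p query) [0..<K])) N (1 + (\<Sum>k<K. ?t k)) (?R K)"
    by (intro couples_append[where R = "\<lambda>_ N'. N' = N0"]) simp_all
  then have "couples \<mu> I (query_prog p query) N (1 + (\<Sum>k<K. ?t k)) (?R K)"
    by (simp add: query_prog_def bind_return_pmf)
  then show ?thesis unfolding \<mu>_def by (rule couples_mono) (use h in auto)
qed

section \<open>Representatives of the curve lengths, and preprocessing\<close>

primrec representative :: "real list list \<Rightarrow> nat \<Rightarrow> nat \<Rightarrow> nat" where
  "representative I 0 i = 0"
| "representative I (Suc j) i = (if length (object I j) = i * d then j else representative I j i)"

text \<open>This includes lengths that do not occur, where the value is 0: every copy must have some
  object in range to read.\<close>

lemma representative_less: "0 < n \<Longrightarrow> j \<le> n \<Longrightarrow> representative I j i < n"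
  by (induction j) auto

lemma representative_length:
  "j < j' \<Longrightarrow> length (object I j) = i * d \<Longrightarrow> length (object I (representative I j' i)) = i * d"
  by (induction j') (auto simp: less_Suc_eq)

text \<open>The encoded length divided by \<open>d\<close> is the number \<open>i\<close> of
  vertices, hence the address \<open>10 + i\<close>. Later objects overwrite earlier ones, which is
  why \<open>representative\<close> prefers the largest index.\<close>

definition scan_body :: prog where
  "scan_body = [Instr (Size 4 3), Instr (Const 5 (real d)), Instr (Arith Div 4 4 5),
     Instr (Const 5 10), Instr (Arith Add 4 4 5), Instr (Store 4 3), Instr (Const 5 1),
     Instr (Arith Add 3 3 5)]"

definition scan :: prog where
  "scan = [Instr (Count 1), Instr (Const 6 1), Instr (Arith Sub 1 1 6), Instr (Const 3 0),
     WhileLe 3 1 scan_body]"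

lemma triple_scan:
  assumes n: "0 < length I"
    and sizes: "\<And>j. j < length I \<Longrightarrow> \<exists>i \<in> {1..m}. length (object I j) = i * d"
  shows "triple I scan Map.empty (4 + (9 * length I + 1))
    (\<lambda>N. low (length I) (representative I (length I)) N \<and> (\<forall>k. part k N = Map.empty))"
proof -
  let ?n = "length I"
  let ?inv = "\<lambda>j N. cell N 3 = real j \<and> low ?n (representative I j) N \<and> (\<forall>k. part k N = Map.empty)"
  have loop: "triple I [WhileLe 3 1 scan_body] N (9 * r + 1) (?inv ?n)"
    if "?inv j N" "j + r = ?n" for r j N
    using that
  proof (induction r arbitrary: j N)
    case 0
    then have "\<not> cell N 3 \<le> cell N 1" by (simp add: low_def)
    then have "triple I [WhileLe 3 1 scan_body] N (Suc 0) (?inv ?n)"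
      using 0 by (simp add: triple_WhileLe)
    then show ?case by simp
  next
    case (Suc r)
    have j: "j < ?n" using Suc.prems by simp
    then obtain i where i: "1 \<le> i" "i \<le> m" "length (object I j) = i * d" using sizes by force
    have inv: "cell N 3 = real j" "low ?n (representative I j) N" "\<And>k. part k N = Map.empty"
      using Suc.prems by auto
    define N1 where "N1 = N(4 \<mapsto> real (10 + i), 10 + i \<mapsto> real j, 5 \<mapsto> 1, 3 \<mapsto> real j + 1)"
    have body: "triple I scan_body N 8 (\<lambda>N'. N' = N1)"
    proof -
      have "index_cell N 3 = j" using inv(1) by (simp add: index_cell_def)
      moreover have "real (i * d) / real d + 10 = real (10 + i)" using d_pos by simp
      ultimately show ?thesis using i inv(1)
        by (simp add: scan_body_def N1_def fun_upd_twist del: of_nat_add of_nat_mult)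
    qed
    have "?inv (Suc j) N1"
    proof -
      have "length (object I j) = i' * d \<longleftrightarrow> i' = i" for i' using i(3) d_pos by auto
      moreover have "part k N1 = Map.empty" for k using inv(3) i by (simp add: N1_def)
      ultimately show ?thesis using inv(2) i by (auto simp: N1_def low_def)
    qed
    then have "triple I [WhileLe 3 1 scan_body] N1 (9 * r + 1) (?inv ?n)"
      by (rule Suc.IH) (use Suc.prems(2) in simp)
    then have "triple I (scan_body @ [WhileLe 3 1 scan_body]) N (8 + (9 * r + 1)) (?inv ?n)"
      using body by (intro triple_append[of I scan_body N 8 "\<lambda>N'. N' = N1"]) simp_all
    moreover have "cell N 3 \<le> cell N 1" using inv(1,2) j by (simp add: low_def)
    ultimately have "triple I [WhileLe 3 1 scan_body] N (Suc (8 + (9 * r + 1))) (?inv ?n)"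
      by (simp only: triple_WhileLe if_True)
    then show ?case by (rule triple_conseq) simp_all
  qed
  let ?N = "Map.empty(6 \<mapsto> 1, 1 \<mapsto> real ?n - 1, 3 \<mapsto> 0)"
  have "triple I [Instr (Count 1), Instr (Const 6 1), Instr (Arith Sub 1 1 6), Instr (Const 3 0)]
    Map.empty 4 (\<lambda>N'. N' = ?N)"
    by (simp add: fun_upd_twist)
  \<comment> \<open>Unwritten cells read as 0, the value of \<open>representative\<close> before any
    object has been seen.\<close>
  moreover have "?inv 0 ?N"
    by (auto simp: low_def cell_def part_def fun_eq_iff loc_def)
  then have "triple I [WhileLe 3 1 scan_body] ?N (9 * ?n + 1) (?inv ?n)"
    by (rule loop) simp
  ultimately have "triple I ([Instr (Count 1), Instr (Const 6 1), Instr (Arith Sub 1 1 6), Instr (Const 3 0)]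
      @ [WhileLe 3 1 scan_body]) Map.empty (4 + (9 * ?n + 1)) (?inv ?n)"
    by (intro triple_append) simp_all
  then show ?thesis unfolding scan_def append.simps by (rule triple_conseq) simp_all
qed

definition prep_prog :: "prog \<Rightarrow> prog" where
  "prep_prog prep = scan @ concat (map (\<lambda>k. compile k prep) [0..<K])"

text \<open>The same scheme as for queries. Each copy finds its part of the memory still empty when
  its turn comes, as the preprocessing of \<open>D\<close> expects.\<close>

lemma couples_prep_prog:
  fixes I :: "real list list"
  defines "n \<equiv> length I" and "\<rho> \<equiv> representative I (length I)"
  assumes n: "0 < n" and L: "0 < L"
    and sizes: "\<And>j. j < length I \<Longrightarrow> \<exists>i \<in> {1..m}. length (object I j) = i * d"
    and view: "\<And>k. k < K \<Longrightarrow> view k n \<rho> (I' k) I"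
    and halts: "\<And>k. k < K \<Longrightarrow> halts_within (I' k) prep Map.empty (t k)" and h: "h < K"
  shows "couples (memory_after (I' h) prep Map.empty (t h)) I (prep_prog prep) Map.empty
    (4 + (9 * n + 1) + (\<Sum>k<K. (19 + 2 * L) * t k)) (\<lambda>M N. low n \<rho> N \<and> part h N = M)"
proof -
  let ?\<mu> = "\<lambda>k. memory_after (I' k) prep Map.empty (t k)"
  let ?t = "\<lambda>k. (19 + 2 * L) * t k"
  let ?R = "\<lambda>i M N. low n \<rho> N \<and> (\<forall>k. i \<le> k \<longrightarrow> k < K \<longrightarrow> part k N = Map.empty) \<and> part h N = M"
  have blocks: "couples (if h < i then ?\<mu> h else return_pmf Map.empty) I
    (concat (map (\<lambda>k. compile k prep) [0..<i])) N (\<Sum>k<i. ?t k) (?R i)"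
    if "i \<le> K" "low n \<rho> N" "\<forall>k. part k N = Map.empty" for i N
    using that
  proof (induction i)
    case 0
    then show ?case by (simp add: couples_return)
  next
    case (Suc i)
    then have i: "i < K" and IH: "couples (if h < i then ?\<mu> h else return_pmf Map.empty) I
      (concat (map (\<lambda>k. compile k prep) [0..<i])) N (\<Sum>k<i. ?t k) (?R i)" by simp_all
    have block: "couples (?\<mu> i) I (compile i prep) N1 (?t i)
      (\<lambda>M N'. low n \<rho> N' \<and> (\<forall>k < K. k \<noteq> i \<longrightarrow> part k N' = part k N1) \<and> part i N' = M)"
      if "?R i M N1" for M N1
    proof -
      have N1: "low n \<rho> N1" "part i N1 = Map.empty" using that i by auto
      have "halts_within (I' i) prep (part i N1) (t i)" using halts[OF i] N1(2) by simp
      from couples_compile[OF i view[OF i] n L N1(1) this]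
      show ?thesis unfolding N1(2)
      proof (rule couples_mono, goal_cases)
        case (2 M N')
        then have "part k N' = part k N1" if "k < K" "k \<noteq> i" for k
          using i that by (intro part_agree[of i]) simp_all
        then show ?case using 2 low_sim[OF N1(1)] by auto
      qed simp
    qed
    have "couples (bind_pmf (if h < i then ?\<mu> h else return_pmf Map.empty)
        (\<lambda>M. if h = i then ?\<mu> h else return_pmf M)) I
      (concat (map (\<lambda>k. compile k prep) [0..<i]) @ compile i prep) N
      ((\<Sum>k<i. ?t k) + ?t i) (?R (Suc i))"
    proof (rule couples_append[OF IH])
      fix M N1 assume R: "?R i M N1"
      show "couples (if h = i then ?\<mu> h else return_pmf M) I (compile i prep) N1 (?t i) (?R (Suc i))"
      proof (cases "h = i")
        case True
        have "couples (?\<mu> i) I (compile i prep) N1 (?t i) (?R (Suc i))"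
          using block[OF R] by (rule couples_mono) (use R True in auto)
        then show ?thesis using True by simp
      next
        case False
        have "triple I (compile i prep) N1 (?t i) (?R (Suc i) M)"
          using couples_support[OF block[OF R]]
          by (rule triple_conseq) (use R False h in auto)
        then show ?thesis using False by (simp add: couples_return)
      qed
    qed
    moreover have "bind_pmf (if h < i then ?\<mu> h else return_pmf Map.empty)
        (\<lambda>M. if h = i then ?\<mu> h else return_pmf M) = (if h < Suc i then ?\<mu> h else return_pmf Map.empty)"
      by (auto simp: bind_return_pmf bind_return_pmf')
    ultimately show ?case by simp
  qed
  have "triple I scan Map.empty (4 + (9 * n + 1))
    (\<lambda>N. low n \<rho> N \<and> (\<forall>k. part k N = Map.empty))"
    using triple_scan n sizes unfolding n_def \<rho>_def by blast
  then have "couples (return_pmf ()) I scan Map.empty (4 + (9 * n + 1))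
    (\<lambda>_ N. low n \<rho> N \<and> (\<forall>k. part k N = Map.empty))"
    by (simp only: couples_return)
  then have "couples (bind_pmf (return_pmf ()) (\<lambda>_. ?\<mu> h)) I
    (scan @ concat (map (\<lambda>k. compile k prep) [0..<K])) Map.empty
    (4 + (9 * n + 1) + (\<Sum>k<K. ?t k)) (?R K)"
    by (rule couples_append) (use blocks[of K] h in auto)
  then have "couples (?\<mu> h) I (prep_prog prep) Map.empty (4 + (9 * n + 1) + (\<Sum>k<K. ?t k)) (?R K)"
    by (simp only: prep_prog_def bind_return_pmf)
  then show ?thesis by (rule couples_mono) simp_all
qed

text \<open>Quotient and remainder by \<open>K\<close> assign every cell above the scratch area to
  one copy.\<close>

lemma card_dom:
  assumes "\<And>k. k < K \<Longrightarrow> finite (dom (part k N)) \<and> real (card (dom (part k N))) \<le> s"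
  shows "real (card (dom N)) \<le> 11 + real m + real K * s"
proof -
  have "dom N \<subseteq> {..<11 + m} \<union> (\<Union>k<K. loc k ` dom (part k N))"
  proof
    fix a assume a: "a \<in> dom N"
    show "a \<in> {..<11 + m} \<union> (\<Union>k<K. loc k ` dom (part k N))"
    proof (cases "a < 11 + m")
      case False
      define k b where "k = (a - (11 + m)) mod K" and "b = (a - (11 + m)) div K"
      have "loc k b = a" using False by (simp add: loc_def k_def b_def)
      moreover have "k < K" using K_pos by (simp add: k_def)
      moreover have "b \<in> dom (part k N)" using a calculation(1) by (auto simp: part_def)
      ultimately show ?thesis by blast
    qed simp
  qed
  moreover have "finite ({..<11 + m} \<union> (\<Union>k<K. loc k ` dom (part k N)))" using assms by simp
  ultimately have "card (dom N) \<le> card ({..<11 + m} \<union> (\<Union>k<K. loc k ` dom (part k N)))"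
    by (intro card_mono)
  also have "\<dots> \<le> card {..<11 + m} + card (\<Union>k<K. loc k ` dom (part k N))"
    by (rule card_Un_le)
  also have "\<dots> \<le> 11 + m + (\<Sum>k<K. card (loc k ` dom (part k N)))"
    using card_UN_le[of "{..<K}"] by simp
  also have "\<dots> \<le> 11 + m + (\<Sum>k<K. card (dom (part k N)))"
    using assms by (intro add_left_mono sum_mono card_image_le) simp
  finally have "real (card (dom N)) \<le> 11 + real m + (\<Sum>k<K. real (card (dom (part k N))))"
    by (simp flip: of_nat_le_iff[where 'a = real])
  also have "(\<Sum>k<K. real (card (dom (part k N)))) \<le> real K * s"
    using sum_bounded_above[of "{..<K}" "\<lambda>k. real (card (dom (part k N)))" s] assms by simp
  finally show ?thesis by simp
qed

end

section \<open>Encodings and stretched curves\<close>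

text \<open>The \<open>SOME\<close> in \<open>coords\<close> does not mention the vector, so one
  enumeration serves all vectors and their coordinates can be compared position by position.\<close>

lemma coords_enumeration:
  obtains xs :: "'d::finite list" where "distinct xs" "set xs = UNIV" "length xs = CARD('d)"
    "\<And>x. coords (x :: real ^ 'd) = map (\<lambda>i. x $ i) xs"
proof -
  define xs :: "'d list" where "xs = (SOME xs. distinct xs \<and> set xs = UNIV)"
  have "\<exists>xs :: 'd list. distinct xs \<and> set xs = UNIV"
    using finite_distinct_list[of "UNIV :: 'd set"] by auto
  then have xs: "distinct xs \<and> set xs = UNIV" unfolding xs_def by (rule someI_ex)
  moreover from xs have "length xs = CARD('d)" using distinct_card by metis
  ultimately show ?thesis by (intro that[of xs]) (simp_all add: coords_def xs_def)
qed

lemma length_coords [simp]: "length (coords (x :: real ^ 'd)) = CARD('d)"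
  by (rule coords_enumeration[where 'd = 'd]) simp

lemma sum_coords_diff:
  fixes x y :: "real ^ 'd"
  shows "(\<Sum>c<CARD('d). (coords x ! c - coords y ! c) ^ 2) = norm (x - y) ^ 2"
proof (rule coords_enumeration)
  fix xs :: "'d list"
  assume xs: "distinct xs" "set xs = UNIV" "length xs = CARD('d)"
    "\<And>x. coords (x :: real ^ 'd) = map (\<lambda>i. x $ i) xs"
  have "(\<Sum>c<CARD('d). (coords x ! c - coords y ! c) ^ 2) = (\<Sum>c<length xs. (x $ (xs ! c) - y $ (xs ! c)) ^ 2)"
    using xs by (intro sum.cong) auto
  also have "\<dots> = (\<Sum>i\<in>UNIV. (x $ i - y $ i) ^ 2)"
    using xs sum_list_distinct_conv_sum_set[OF xs(1), of "\<lambda>i. (x $ i - y $ i) ^ 2"]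
    by (simp add: sum_list_sum_nth atLeast0LessThan)
  also have "\<dots> = norm (x - y) ^ 2"
    by (simp add: norm_vec_def L2_set_def sum_nonneg)
  finally show ?thesis .
qed

lemma length_encode [simp]: "length (encode (V :: (real ^ 'd) list)) = length V * CARD('d)"
  by (induction V) (simp_all add: encode_def)

lemma entry_encode:
  fixes V :: "(real ^ 'd) list"
  assumes "c < CARD('d)"
  shows "entry (encode V) (i * CARD('d) + c) = (if i < length V then coords (V ! i) ! c else 0)"
proof (induction V arbitrary: i)
  case Nil
  then show ?case by (simp add: encode_def entry_def)
next
  case (Cons x V)
  have enc: "encode (x # V) = coords x @ encode V" by (simp add: encode_def)
  show ?case
  proof (cases i)
    case 0
    then show ?thesis using assms by (simp add: enc entry_def nth_append)
  next
    case (Suc i')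
    then have "entry (encode (x # V)) (i * CARD('d) + c) = entry (encode V) (i' * CARD('d) + c)"
      using assms by (simp add: enc entry_def nth_append)
    then show ?thesis using Cons.IH[of i'] Suc by simp
  qed
qed

definition stretch :: "nat list \<Rightarrow> (real ^ 'd) list \<Rightarrow> (real ^ 'd) list" where
  "stretch xs V = map (\<lambda>i. if i < length V then V ! i else 0) xs"

lemma length_stretch [simp]: "length (stretch xs V) = length xs"
  by (simp add: stretch_def)

lemma coords_zero: "c < CARD('d) \<Longrightarrow> coords (0 :: real ^ 'd) ! c = 0"
  by (rule coords_enumeration[where 'd = 'd]) simp

text \<open>The filler index \<open>m\<close> lies beyond every curve of length at most
  \<open>m\<close>. Thus kept vertices, padding and reads past the end obey one formula, the one
  that \<open>view\<close> asks for.\<close>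

lemma entry_encode_stretch:
  fixes V :: "(real ^ 'd) list"
  assumes "length V \<le> m"
  shows "entry (encode (stretch xs V)) e =
    entry (encode V) (nth_default m xs (e div CARD('d)) * CARD('d) + e mod CARD('d))"
proof -
  let ?d = "CARD('d)" and ?q = "e div CARD('d)" and ?r = "e mod CARD('d)"
  have r: "?r < ?d" by simp
  have "entry (encode (stretch xs V)) e = entry (encode (stretch xs V)) (?q * ?d + ?r)" by simp
  also have "\<dots> = (if ?q < length xs then coords (stretch xs V ! ?q) ! ?r else 0)"
    by (simp only: entry_encode[OF r] length_stretch)
  also have "\<dots> = entry (encode V) (nth_default m xs ?q * ?d + ?r)"
    unfolding entry_encode[OF r] using assms r
    by (auto simp: stretch_def nth_default_def coords_zero)
  finally show ?thesis .
qed

section \<open>Traversals as lattice walks\<close>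

definition moves :: "(nat \<times> nat) list" where "moves = [(0, 1), (1, 0), (1, 1)]"

fun walk :: "nat \<times> nat \<Rightarrow> (nat \<times> nat) list \<Rightarrow> (nat \<times> nat) list" where
  "walk s [] = [s]"
| "walk s (w # ws) = s # walk (fst s + fst w, snd s + snd w) ws"

lemma walk_neq_Nil [simp]: "walk s ws \<noteq> []" by (cases ws) auto

lemma hd_walk [simp]: "hd (walk s ws) = s" by (cases ws) auto

lemma length_walk [simp]: "length (walk s ws) = Suc (length ws)"
  by (induction s ws rule: walk.induct) auto

lemma walk_bounds:
  "xy \<in> set (walk s ws) \<Longrightarrow> fst s \<le> fst xy \<and> fst xy \<le> fst (last (walk s ws)) \<and>
    snd s \<le> snd xy \<and> snd xy \<le> snd (last (walk s ws))"
proof (induction s ws arbitrary: xy rule: walk.induct)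
  case (2 s w ws)
  have "last (walk (fst s + fst w, snd s + snd w) ws) \<in> set (walk (fst s + fst w, snd s + snd w) ws)"
    by simp
  from 2(1)[OF this] 2 show ?case by fastforce
qed simp

text \<open>Each move raises the coordinate sum by at least 1. From \<open>(1, 1)\<close> to a point
  with coordinates at most \<open>m\<close> there are thus at most \<open>2 * m - 2\<close> moves,
  which is where the sequence length \<open>2 * m - 1\<close> comes from.\<close>

lemma walk_length_le:
  "set ws \<subseteq> set moves \<Longrightarrow>
   fst s + snd s + length ws \<le> fst (last (walk s ws)) + snd (last (walk s ws))"
  by (induction s ws rule: walk.induct) (auto simp: moves_def)

text \<open>The local condition of \<open>traversal\<close> without the endpoints: removing the
  first pair does not preserve the start \<open>(1, 1)\<close>, so the induction needs the condition
  alone.\<close>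

definition steps_ok :: "(nat \<times> nat) list \<Rightarrow> bool" where
  "steps_ok T \<longleftrightarrow> (\<forall>k. Suc k < length T \<longrightarrow>
     (let di = int (fst (T ! Suc k)) - int (fst (T ! k));
          dj = int (snd (T ! Suc k)) - int (snd (T ! k))
      in di \<in> {0, 1} \<and> dj \<in> {0, 1} \<and> di + dj \<ge> 1))"

lemma steps_ok_Cons:
  assumes "T \<noteq> []"
  shows "steps_ok (s # T) \<longleftrightarrow> steps_ok T \<and>
    (\<exists>w \<in> set moves. hd T = (fst s + fst w, snd s + snd w))"
proof -
  have hd: "hd T = T ! 0" using assms by (simp add: hd_conv_nth)
  have "steps_ok (s # T) \<longleftrightarrow> steps_ok T \<and>
    (let di = int (fst (hd T)) - int (fst s); dj = int (snd (hd T)) - int (snd s)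
     in di \<in> {0, 1} \<and> dj \<in> {0, 1} \<and> di + dj \<ge> 1)"
  proof -
    have split: "(\<forall>k. P k) \<longleftrightarrow> P 0 \<and> (\<forall>k. P (Suc k))" for P :: "nat \<Rightarrow> bool"
      by (metis nat.exhaust)
    show ?thesis unfolding steps_ok_def hd using assms
      by (subst split) (auto simp: Let_def)
  qed
  also have "(let di = int (fst (hd T)) - int (fst s); dj = int (snd (hd T)) - int (snd s)
     in di \<in> {0, 1} \<and> dj \<in> {0, 1} \<and> di + dj \<ge> 1) \<longleftrightarrow>
    (\<exists>w \<in> set moves. hd T = (fst s + fst w, snd s + snd w))"
    by (cases "hd T"; cases s) (auto simp: moves_def Let_def)
  finally show ?thesis .
qed

lemma steps_ok_iff_walk:
  assumes "T \<noteq> []"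
  shows "steps_ok T \<longleftrightarrow> (\<exists>ws. set ws \<subseteq> set moves \<and> T = walk (hd T) ws)"
  using assms
proof (induction T rule: list_nonempty_induct)
  case (single s)
  have "set [] \<subseteq> set moves \<and> [s] = walk s []" by simp
  then show ?case by (auto simp: steps_ok_def intro: exI[of _ "[]"])
next
  case (cons s T)
  show ?case
  proof
    assume "steps_ok (s # T)"
    then obtain w ws where "w \<in> set moves" "hd T = (fst s + fst w, snd s + snd w)"
      "set ws \<subseteq> set moves" "T = walk (hd T) ws"
      using cons by (auto simp: steps_ok_Cons)
    then have "set (w # ws) \<subseteq> set moves \<and> s # T = walk (hd (s # T)) (w # ws)" by simp
    then show "\<exists>ws. set ws \<subseteq> set moves \<and> s # T = walk (hd (s # T)) ws" by blast
  next
    assume "\<exists>ws. set ws \<subseteq> set moves \<and> s # T = walk (hd (s # T)) ws"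
    then obtain ws where ws: "set ws \<subseteq> set moves" "s # T = walk s ws" by auto
    then show "steps_ok (s # T)"
      using cons by (cases ws) (auto simp: steps_ok_Cons)
  qed
qed

lemma traversal_iff_walk:
  "traversal m1 m2 T \<longleftrightarrow>
     (\<exists>ws. set ws \<subseteq> set moves \<and> T = walk (1, 1) ws \<and> last T = (m1, m2))"
proof -
  have "traversal m1 m2 T \<longleftrightarrow> T \<noteq> [] \<and> hd T = (1, 1) \<and> last T = (m1, m2) \<and> steps_ok T"
    by (simp add: traversal_def steps_ok_def)
  then show ?thesis using steps_ok_iff_walk[of T] by (metis hd_walk walk_neq_Nil)
qed

text \<open>Together with \<open>traversal_exists\<close> this makes the \<open>Min\<close> in
  \<open>curve_dist\<close> a true minimum.\<close>

lemma finite_traversals: "finite {T. traversal m1 m2 T}"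
proof (rule finite_subset)
  show "{T. traversal m1 m2 T} \<subseteq> walk (1, 1) ` {ws. set ws \<subseteq> set moves \<and> length ws \<le> m1 + m2}"
  proof
    fix T assume "T \<in> {T. traversal m1 m2 T}"
    then obtain ws where ws: "set ws \<subseteq> set moves" "T = walk (1, 1) ws" "last T = (m1, m2)"
      by (auto simp: traversal_iff_walk)
    then have "length ws \<le> m1 + m2" using walk_length_le[OF ws(1), of "(1, 1)"] by simp
    with ws show "T \<in> walk (1, 1) ` {ws. set ws \<subseteq> set moves \<and> length ws \<le> m1 + m2}" by blast
  qed
qed (simp add: finite_lists_length_le)

lemma last_walk_append: "last (walk s (us @ ws)) = last (walk (last (walk s us)) ws)"
  by (induction s us rule: walk.induct) auto

lemma traversal_exists:
  assumes "1 \<le> m1" "1 \<le> m2"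
  shows "\<exists>T. traversal m1 m2 T"
proof -
  have right: "last (walk s (replicate k (1, 0))) = (fst s + k, snd s)" for s k
    by (induction k arbitrary: s) auto
  have up: "last (walk s (replicate k (0, 1))) = (fst s, snd s + k)" for s k
    by (induction k arbitrary: s) auto
  let ?ws = "replicate (m1 - 1) (1, 0) @ replicate (m2 - 1) (0, 1)"
  have "set ?ws \<subseteq> set moves" by (auto simp: moves_def)
  moreover have "last (walk (1, 1) ?ws) = (m1, m2)"
    using assms by (simp add: last_walk_append right up del: One_nat_def)
  ultimately show ?thesis unfolding traversal_iff_walk by blast
qed

section \<open>The curve distance as an attained minimum\<close>

definition traversal_cost ::
  "real \<Rightarrow> (real ^ 'd) list \<Rightarrow> (real ^ 'd) list \<Rightarrow> (nat \<times> nat) list \<Rightarrow> real" where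
  "traversal_cost p V U T = (\<Sum>(i, j)\<leftarrow>T. norm (V ! (i - 1) - U ! (j - 1)) powr p)"

lemma curve_dist_le:
  assumes "traversal (length V) (length U) T"
  shows "curve_dist p V U \<le> traversal_cost p V U T powr (1 / p)"
  unfolding curve_dist_def traversal_cost_def
proof (rule Min_le)
  have "{(\<Sum>(i, j)\<leftarrow>T. norm (V ! (i - 1) - U ! (j - 1)) powr p) powr (1 / p) | T.
      traversal (length V) (length U) T} =
    (\<lambda>T. (\<Sum>(i, j)\<leftarrow>T. norm (V ! (i - 1) - U ! (j - 1)) powr p) powr (1 / p)) `
      {T. traversal (length V) (length U) T}" by auto
  then show "finite {(\<Sum>(i, j)\<leftarrow>T. norm (V ! (i - 1) - U ! (j - 1)) powr p) powr (1 / p) | T.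
      traversal (length V) (length U) T}" using finite_traversals by simp
qed (use assms in auto)

lemma curve_dist_attained:
  assumes "V \<noteq> []" "U \<noteq> []"
  obtains T where "traversal (length V) (length U) T"
    "curve_dist p V U = traversal_cost p V U T powr (1 / p)"
proof -
  let ?f = "\<lambda>T. (\<Sum>(i, j)\<leftarrow>T. norm (V ! (i - 1) - U ! (j - 1)) powr p) powr (1 / p)"
  let ?Ts = "{T. traversal (length V) (length U) T}"
  have "?Ts \<noteq> {}" using traversal_exists[of "length V" "length U"] assms
    by (auto simp: Suc_le_eq)
  then have "Min (?f ` ?Ts) \<in> ?f ` ?Ts" using finite_traversals by (intro Min_in) auto
  moreover have "curve_dist p V U = Min (?f ` ?Ts)"
    unfolding curve_dist_def by (rule arg_cong[of _ _ Min]) auto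
  ultimately show ?thesis using that by (auto simp: traversal_cost_def)
qed

section \<open>Enumeration and number of walks\<close>

definition words :: "nat \<Rightarrow> (nat \<times> nat) list list" where
  "words n = concat (map (\<lambda>i. List.n_lists i moves) [0..<n])"

lemma set_words: "set (words n) = {ws. length ws < n \<and> set ws \<subseteq> set moves}"
  by (auto simp: words_def set_n_lists)

text \<open>A geometric series: there are \<open>3 ^ i\<close> words with \<open>i\<close>
  moves.\<close>

lemma length_words: "2 * length (words n) + 1 = 3 ^ n"
proof (induction n)
  case (Suc n)
  have "length moves = 3" by (simp add: moves_def)
  then show ?case using Suc by (simp add: words_def length_n_lists)
qed (simp add: words_def)

text \<open>Walks are monotone, so bounding the endpoint bounds the whole walk. The endpoint also
  tells which pair of curve lengths the walk fits.\<close>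

definition walks :: "nat \<Rightarrow> (nat \<times> nat) list list" where
  "walks m = filter (\<lambda>T. fst (last T) \<le> m \<and> snd (last T) \<le> m) (map (walk (1, 1)) (words (2 * m - 1)))"

definition pad :: "nat \<Rightarrow> nat list \<Rightarrow> nat list" where
  "pad m xs = xs @ replicate (2 * m - 1 - length xs) m"

text \<open>Distances are taken from the query to the data, so the second component of a pair is the
  data vertex. Subtracting 1 passes from indices that start at 1 to list positions.\<close>

definition data_table :: "nat \<Rightarrow> nat \<Rightarrow> nat list" where
  "data_table m k = pad m (map (\<lambda>xy. snd xy - 1) (walks m ! k))"

definition query_table :: "nat \<Rightarrow> nat \<Rightarrow> nat list" where
  "query_table m k = pad m (map (\<lambda>xy. fst xy - 1) (walks m ! k))"

lemma walks_traversal: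
  assumes "T \<in> set (walks m)"
  shows "traversal (fst (last T)) (snd (last T)) T" "length T \<le> 2 * m - 1"
    "1 \<le> fst (last T)" "fst (last T) \<le> m" "1 \<le> snd (last T)" "snd (last T) \<le> m"
proof -
  obtain ws where ws: "T = walk (1, 1) ws" "length ws < 2 * m - 1" "set ws \<subseteq> set moves"
    "fst (last T) \<le> m" "snd (last T) \<le> m"
    using assms by (auto simp: walks_def set_words)
  then show "length T \<le> 2 * m - 1" "fst (last T) \<le> m" "snd (last T) \<le> m" by simp_all
  show "traversal (fst (last T)) (snd (last T)) T"
    using ws unfolding traversal_iff_walk by (metis prod.collapse)
  show "1 \<le> fst (last T)" "1 \<le> snd (last T)"
    using walk_bounds[of "(1, 1)" "(1, 1)" ws] hd_in_set[of "walk (1, 1) ws"] ws(1) by auto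
qed

lemma traversal_in_walks:
  assumes "traversal a b T" "a \<le> m" "b \<le> m" "1 \<le> m"
  shows "T \<in> set (walks m)"
proof -
  obtain ws where ws: "set ws \<subseteq> set moves" "T = walk (1, 1) ws" "last T = (a, b)"
    using assms(1) by (auto simp: traversal_iff_walk)
  have "length ws < 2 * m - 1"
    using walk_length_le[OF ws(1), of "(1, 1)"] ws assms by simp
  then show ?thesis using ws assms by (auto simp: walks_def set_words)
qed

lemma length_pad: "length xs \<le> 2 * m - 1 \<Longrightarrow> length (pad m xs) = 2 * m - 1"
  by (simp add: pad_def)

lemma length_tables:
  assumes "k < length (walks m)"
  shows "length (data_table m k) = 2 * m - 1" "length (query_table m k) = 2 * m - 1"
  using walks_traversal(2)[of "walks m ! k" m] assms
  by (simp_all add: data_table_def query_table_def length_pad)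

lemma length_walks: "2 * length (walks m) + 1 \<le> 3 ^ (2 * m - 1)"
proof -
  have "length (walks m) \<le> length (words (2 * m - 1))"
    unfolding walks_def by (rule order_trans[OF length_filter_le]) simp
  then show ?thesis using length_words[of "2 * m - 1"] by linarith
qed

lemma walks_neq_Nil:
  assumes "1 \<le> m"
  shows "walks m \<noteq> []"
proof -
  obtain T where "traversal 1 1 T" using traversal_exists[of 1 1] by auto
  then have "T \<in> set (walks m)" by (rule traversal_in_walks) (use assms in simp_all)
  then show ?thesis by auto
qed

text \<open>\<open>55 + 4 * m\<close> is the cost per copy in the query bound, the most demanding of
  the three: \<open>17 + 4 * m\<close> for the simulation, 36 for the evaluation, 2 for reading the
  query and the first instruction.\<close>

lemma walks_factor:
  assumes "1 \<le> m"
  shows "real (length (walks m)) * (55 + 4 * real m) \<le> (4 * exp 1) ^ (m + 1)"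
proof -
  have "3 ^ (2 * m - 1) * 3 = (9 :: real) ^ m"
    using assms by (simp add: power_mult[symmetric] flip: power_Suc2) (simp add: power_mult)
  moreover have "2 * real (length (walks m)) \<le> 3 ^ (2 * m - 1)"
  proof -
    have "real (2 * length (walks m)) \<le> real (3 ^ (2 * m - 1))"
      using length_walks[of m] by (intro of_nat_mono) linarith
    then show ?thesis by simp
  qed
  ultimately have K: "6 * real (length (walks m)) \<le> 9 ^ m" by simp
  \<comment> \<open>\<open>(11 / 10) ^ 10\<close> exceeds 2.593, which gives the lower bound 10.37
    for \<open>4 * exp 1\<close>.\<close>
  have "(11 / 10) ^ 10 \<le> exp (1 / 10 :: real) ^ 10"
    using exp_ge_add_one_self[of "1 / 10 :: real"] by (intro power_mono) simp_all
  also have "\<dots> = exp 1" by (simp flip: exp_of_nat_mult)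
  finally have e: "1037 / 100 \<le> 4 * exp (1 :: real)" by (simp add: power_divide)
  have "6 * (real (length (walks m)) * (55 + 4 * real m)) \<le> 9 ^ m * (55 + 4 * real m)"
    using mult_right_mono[OF K, of "55 + 4 * real m"] by simp
  \<comment> \<open>The rate \<open>9 * (1 + 3 / 20) = 207 / 20\<close> stays just below
    \<open>1037 / 100\<close>, so Bernoulli's inequality absorbs the linear factor. The 6 comes from
    the bound on the number of walks, the separate \<open>1037 / 100\<close> from the exponent
    \<open>m + 1\<close>.\<close>
  also have "\<dots> \<le> 9 ^ m * (6 * (1037 / 100) * (1 + real m * (3 / 20)))"
    by (intro mult_left_mono) simp_all
  also have "\<dots> \<le> 9 ^ m * (6 * (1037 / 100) * (1 + 3 / 20) ^ m)"
    using Bernoulli_inequality[of "3 / 20 :: real" m] by (intro mult_left_mono) simp_all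
  also have "\<dots> = 6 * ((1037 / 100) * (207 / 20) ^ m)"
    by (simp add: power_mult_distrib[symmetric] ac_simps)
  also have "\<dots> \<le> 6 * ((4 * exp 1) * (4 * exp 1) ^ m)"
    using e by (intro mult_left_mono mult_mono power_mono) simp_all
  finally have "real (length (walks m)) * (55 + 4 * real m) \<le> (4 * exp 1) * (4 * exp 1) ^ m"
    by (simp only: mult_le_cancel_left_pos zero_less_numeral)
  then show ?thesis by (simp only: Suc_eq_plus1[symmetric] power_Suc)
qed

section \<open>The cost of a walk as a product distance\<close>

lemma stretched_cost:
  fixes V q :: "(real ^ 'd) list"
  assumes "length xs = length ys"
  shows "(\<Sum>xy\<leftarrow>zip xs ys. (\<Sum>c<CARD('d). (entry (encode V) (fst xy * CARD('d) + c) -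
      entry (encode q) (snd xy * CARD('d) + c)) ^ 2) powr (p / 2))
    = (\<Sum>i<length ys. norm (stretch ys q ! i - stretch xs V ! i) powr p)"
proof -
  have coord: "entry (encode W) (i * CARD('d) + c) = coords (if i < length W then W ! i else 0) ! c"
    if "c < CARD('d)" for W :: "(real ^ 'd) list" and i c
    using that by (simp add: entry_encode coords_zero)
  have sq: "(z ^ 2) powr (p / 2) = z powr p" if "0 \<le> z" for z :: real
  proof -
    have "z ^ 2 = z powr 2" using that by simp
    then show ?thesis by (simp only: powr_powr) simp
  qed
  have "(\<Sum>c<CARD('d). (entry (encode V) (xs ! i * CARD('d) + c) -
      entry (encode q) (ys ! i * CARD('d) + c)) ^ 2) powr (p / 2)
    = norm (stretch ys q ! i - stretch xs V ! i) powr p" if "i < length ys" for i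
  proof -
    have "(\<Sum>c<CARD('d). (entry (encode V) (xs ! i * CARD('d) + c) -
        entry (encode q) (ys ! i * CARD('d) + c)) ^ 2)
      = (\<Sum>c<CARD('d). (coords (stretch xs V ! i) ! c - coords (stretch ys q ! i) ! c) ^ 2)"
    proof (rule sum.cong[OF refl])
      fix c assume "c \<in> {..<CARD('d)}"
      then have c: "c < CARD('d)" by simp
      show "(entry (encode V) (xs ! i * CARD('d) + c) - entry (encode q) (ys ! i * CARD('d) + c)) ^ 2
        = (coords (stretch xs V ! i) ! c - coords (stretch ys q ! i) ! c) ^ 2"
        unfolding coord[OF c] using that assms by (simp add: stretch_def)
    qed
    also have "\<dots> = norm (stretch ys q ! i - stretch xs V ! i) ^ 2"
      by (simp only: sum_coords_diff norm_minus_commute)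
    finally show ?thesis by (simp only: sq norm_ge_zero)
  qed
  then show ?thesis using assms by (simp add: sum_list_sum_nth atLeast0LessThan)
qed

text \<open>As the walk ends at the pair of lengths, all its pairs index genuine vertices. In the
  padding both sequences have the zero vector, and \<open>0 powr p = 0\<close> makes it free of
  cost.\<close>

lemma table_cost:
  fixes V q :: "(real ^ 'd) list"
  assumes k: "k < length (walks m)" and q: "length q = fst (last (walks m ! k))"
    and V: "length V = snd (last (walks m ! k))"
  shows "(\<Sum>i<2 * m - 1. norm (stretch (query_table m k) q ! i - stretch (data_table m k) V ! i) powr p)
    = traversal_cost p q V (walks m ! k)"
proof -
  let ?T = "walks m ! k"
  let ?f = "\<lambda>i. norm (stretch (query_table m k) q ! i - stretch (data_table m k) V ! i) powr p"
  have T: "?T \<in> set (walks m)" using k by simp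
  note T_props = walks_traversal[OF T]
  obtain ws where ws: "?T = walk (1, 1) ws" using T_props(1) by (auto simp: traversal_iff_walk)
  have near: "?f i = (case ?T ! i of (x, y) \<Rightarrow> norm (q ! (x - 1) - V ! (y - 1)) powr p)"
    if "i < length ?T" for i
  proof -
    have "?T ! i \<in> set (walk (1, 1) ws)" using that ws by (metis nth_mem)
    from walk_bounds[OF this] have "fst (?T ! i) - 1 < length q" "snd (?T ! i) - 1 < length V"
      using q V ws by auto
    then show ?thesis using that T_props(2)
      by (simp add: stretch_def query_table_def data_table_def pad_def nth_append case_prod_beta)
  qed
  have far: "?f i = 0" if "length ?T \<le> i" "i < 2 * m - 1" for i
    using that q V T_props
    by (simp add: stretch_def query_table_def data_table_def pad_def nth_append)
  have "(\<Sum>i<2 * m - 1. ?f i) = (\<Sum>i<length ?T. ?f i)"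
    using T_props(2) far by (intro sum.mono_neutral_right) auto
  also have "\<dots> = (\<Sum>i<length ?T. case ?T ! i of (x, y) \<Rightarrow> norm (q ! (x - 1) - V ! (y - 1)) powr p)"
    using near by (intro sum.cong) auto
  finally show ?thesis by (simp add: traversal_cost_def sum_list_sum_nth atLeast0LessThan)
qed

section \<open>The composite data structure\<close>

lemma object_append:
  "object (I @ J) j = (if j < length I then object I j else object J (j - length I))"
  by (auto simp: object_def nth_append)

lemma object_map_encode: "j < length X \<Longrightarrow> object (map encode X) j = encode (X ! j)"
  by (simp add: object_def)

text \<open>The coupling transports the mass of \<open>G\<close> into \<open>H\<close>, so the
  composite fails at most as often as the one coupled copy.\<close>

lemma rel_pmf_prob_le:
  assumes "rel_pmf R \<mu> \<nu>" "\<And>x y. R x y \<Longrightarrow> x \<in> G \<Longrightarrow> y \<in> H"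
  shows "measure_pmf.prob \<nu> (- H) \<le> measure_pmf.prob \<mu> (- G)"
proof -
  have "measure_pmf.prob \<mu> G \<le> measure_pmf.prob \<nu> {y. \<exists>x\<in>G. R x y}"
    using assms(1) by (rule rel_pmf_measureD)
  also have "\<dots> \<le> measure_pmf.prob \<nu> H"
    using assms(2) by (intro measure_pmf.finite_measure_mono) auto
  finally show ?thesis
    using measure_pmf.prob_compl[of G \<mu>] measure_pmf.prob_compl[of H \<nu>]
    by (simp add: Compl_eq_Diff_UNIV)
qed

context layout begin

definition stretched_data :: "nat \<Rightarrow> (nat \<Rightarrow> nat) \<Rightarrow> (real ^ 'd) list list \<Rightarrow> (real ^ 'd) list list" where
  "stretched_data k \<rho> X =
     map (\<lambda>V. stretch (A k) (if length V = E k then V else X ! \<rho> (E k))) X"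

text \<open>\<open>Y\<close> is \<open>[]\<close> during preprocessing and \<open>[q]\<close> during
  a query. Curves are nonempty, which is why size 0 identifies an index without an object.\<close>

lemma view_stretched:
  fixes X Y :: "(real ^ 'd) list list"
  assumes d: "d = CARD('d)" and k: "k < K" and \<rho>: "\<rho> (E k) < length X"
    and len: "\<And>V. V \<in> set X \<union> set Y \<Longrightarrow> V \<noteq> [] \<and> length V \<le> m"
  shows "view k (length X) \<rho> (map encode (stretched_data k \<rho> X) @ map encode (map (stretch (B k)) Y))
    (map encode X @ map encode Y)"
proof -
  let ?I = "map encode X @ map encode Y" and ?n = "length X"
  let ?I' = "map encode (stretched_data k \<rho> X) @ map encode (map (stretch (B k)) Y)"
  have obj: "length (object ?I' j) = (if object ?I j = [] then 0 else L * d) \<and>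
    (\<forall>e. entry (object ?I' j) e = entry (object ?I (if j < ?n then redirected k \<rho> ?I j else j))
      (nth_default m (if j < ?n then A k else B k) (e div d) * d + e mod d))" for j
  proof -
    consider "j < ?n" | "?n \<le> j" "j < ?n + length Y" | "?n + length Y \<le> j" by linarith
    then show ?thesis
    proof cases
      case 1
      let ?V = "if length (X ! j) = E k then X ! j else X ! \<rho> (E k)"
      have I': "object ?I' j = encode (stretch (A k) ?V)"
        using 1 by (simp add: object_append object_map_encode stretched_data_def del: map_map)
      have I: "object ?I j = encode (X ! j)" using 1 by (simp add: object_append object_map_encode)
      have "length (object ?I j) = E k * d \<longleftrightarrow> length (X ! j) = E k" using d_pos by (simp add: I flip: d)
      then have red: "object ?I (redirected k \<rho> ?I j) = encode ?V"
        using 1 \<rho> by (simp add: redirected_def object_append object_map_encode)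
      have "length ?V \<le> m" using len[of "X ! j"] len[of "X ! \<rho> (E k)"] 1 \<rho> by simp
      then have "\<forall>e. entry (object ?I' j) e = entry (encode ?V) (nth_default m (A k) (e div d) * d + e mod d)"
        unfolding I' by (intro allI entry_encode_stretch[where 'd = 'd, folded d])
      moreover have "encode (X ! j) \<noteq> []"
        using len[of "X ! j"] 1 by (simp flip: length_greater_0_conv)
      ultimately show ?thesis using 1 red length_A[OF k] by (simp add: I I' del: map_map flip: d)
    next
      case 2
      define j' where "j' = j - ?n"
      have j': "j' < length Y" using 2 by (simp add: j'_def)
      have I': "object ?I' j = encode (stretch (B k) (Y ! j'))"
        using 2 j' by (simp add: object_append object_map_encode stretched_data_def j'_def del: map_map)
      have I: "object ?I j = encode (Y ! j')"
        using 2 j' by (simp add: object_append object_map_encode j'_def)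
      have "length (Y ! j') \<le> m" using len[of "Y ! j'"] j' by simp
      then have "\<forall>e. entry (object ?I' j) e =
          entry (encode (Y ! j')) (nth_default m (B k) (e div d) * d + e mod d)"
        unfolding I' by (intro allI entry_encode_stretch[where 'd = 'd, folded d])
      moreover have "encode (Y ! j') \<noteq> []"
        using len[of "Y ! j'"] j' by (simp flip: length_greater_0_conv)
      ultimately show ?thesis using 2 length_B[OF k] by (simp add: I I' del: map_map flip: d)
    next
      case 3
      then show ?thesis by (simp add: object_def stretched_data_def entry_def)
    qed
  qed
  then show ?thesis unfolding view_def by (simp add: stretched_data_def)
qed

lemma cost_eq:
  fixes V q :: "(real ^ 'd) list"
  assumes "d = CARD('d)" "k < K"
  shows "cost p k (encode q) (encode V) =
    (\<Sum>i<L. norm (stretch (B k) q ! i - stretch (A k) V ! i) powr p)"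
  unfolding cost_def point_cost_def
  unfolding assms(1)
  using stretched_cost[of "A k" "B k" V q p] length_A[OF assms(2)] length_B[OF assms(2)] by simp

lemma lp_product_dist_stretch:
  fixes V q :: "(real ^ 'd) list"
  assumes "d = CARD('d)" "k < K"
  shows "lp_product_dist p (stretch (B k) q) (stretch (A k) V) =
    cost p k (encode q) (encode V) powr (1 / p)"
  using length_B[OF assms(2)] by (simp add: lp_product_dist_def cost_eq[OF assms])

end

lemma ann_structureD:
  assumes "ann_structure Obj d \<epsilon> \<delta> S T Q (prep, query)" "X \<noteq> []" "set X \<subseteq> Obj"
  shows "\<exists>t. halts_within (map encode X) prep Map.empty t \<and>
    real (input_size (map encode X)) + real t \<le> T (length X) \<and>
    (\<forall>M \<in> set_pmf (memory_after (map encode X) prep Map.empty t).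
       real (input_size (map encode X)) + real (card (dom M)) \<le> S (length X)) \<and>
    (\<forall>q \<in> Obj. \<exists>u.
       (\<forall>M \<in> set_pmf (memory_after (map encode X) prep Map.empty t).
          halts_within (map encode X @ [encode q]) query M u) \<and>
       real (length (encode q) + u) \<le> Q (length X) \<and>
       measure_pmf.prob (bind_pmf (memory_after (map encode X) prep Map.empty t)
         (\<lambda>M. memory_after (map encode X @ [encode q]) query M u))
         {M. \<not> ann_answer d \<epsilon> X q (index_cell M 0)} < \<delta>)"
  using assms unfolding ann_structure_def by (simp add: Let_def)

lemma input_size_encode_le:
  fixes X :: "(real ^ 'd) list list"
  assumes "\<And>V. V \<in> set X \<Longrightarrow> length V \<le> l"
  shows "input_size (map encode X) \<le> length X * (l * CARD('d))"
  using assms by (induction X) (auto simp: input_size_def intro!: add_mono)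

lemma input_size_encode_eq:
  fixes X :: "(real ^ 'd) list list"
  assumes "\<And>V. V \<in> set X \<Longrightarrow> length V = l"
  shows "input_size (map encode X) = length X * (l * CARD('d))"
  using assms by (induction X) (auto simp: input_size_def)

theorem theorem14:
  fixes p \<epsilon> :: real and m :: nat and S T Q :: "nat \<Rightarrow> real"
  assumes "1 \<le> p" and "0 < \<epsilon>"
    and "\<forall>l \<in> {1..<2 * m}. \<exists>D.
           ann_structure (point_sequences l :: (real ^ 'd) list set) (lp_product_dist p) \<epsilon>
             (2 powr (- 4 * real m - 1)) S T Q D"
  shows "\<exists>D.
           ann_structure (curves_upto m :: (real ^ 'd) list set) (curve_dist p) \<epsilon> (1 / 2)
             (\<lambda>n. (4 * exp 1) ^ (m + 1) * S n)
             (\<lambda>n. (4 * exp 1) ^ (m + 1) * T n)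
             (\<lambda>n. (4 * exp 1) ^ (m + 1) * Q n) D"
proof (cases "m = 0")
  case True
  \<comment> \<open>No nonempty list of objects exists, so any pair of programs qualifies.\<close>
  then have "(curves_upto m :: (real ^ 'd) list set) = {}" by (auto simp: curves_upto_def)
  then show ?thesis by (simp add: ann_structure_def)
next
  case False
  then have m: "1 \<le> m" by simp
  let ?d = "CARD('d)" and ?L = "2 * m - 1" and ?K = "length (walks m)"
  let ?E = "\<lambda>k. snd (last (walks m ! k))" and ?F = "\<lambda>k. fst (last (walks m ! k))"
  let ?G = "(4 * exp 1 :: real) ^ (m + 1)" and ?\<delta> = "2 powr (- 4 * real m - 1)"
  interpret layout ?d ?L m ?K "data_table m" "query_table m" ?E ?F
  proof
    show "0 < ?K" using walks_neq_Nil[OF m] by simp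
    show "1 \<le> ?E k \<and> ?E k \<le> m" if "k < ?K" for k
      using walks_traversal[of "walks m ! k" m] that by simp
  qed (simp_all add: length_tables)
  have L: "0 < ?L" using m by simp
  have K: "0 < ?K" using walks_neq_Nil[OF m] by simp
  have G: "real ?K * (55 + 4 * real m) \<le> ?G" using m by (rule walks_factor)
  have "?L \<in> {1..<2 * m}" using m by simp
  with assms(3) obtain D where "ann_structure (point_sequences ?L :: (real ^ 'd) list set)
    (lp_product_dist p) \<epsilon> ?\<delta> S T Q D" by blast
  then obtain prep query where D: "ann_structure (point_sequences ?L :: (real ^ 'd) list set)
    (lp_product_dist p) \<epsilon> ?\<delta> S T Q (prep, query)" by (cases D) auto
  have "ann_structure (curves_upto m :: (real ^ 'd) list set) (curve_dist p) \<epsilon> (1 / 2)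
    (\<lambda>n. ?G * S n) (\<lambda>n. ?G * T n) (\<lambda>n. ?G * Q n) (prep_prog prep, query_prog p query)"
    unfolding ann_structure_def prod.case
  proof (intro allI impI, elim conjE)
    fix X :: "(real ^ 'd) list list"
    assume X: "X \<noteq> []" "set X \<subseteq> curves_upto m"
    define n where "n = length X"
    define I where "I = map encode X"
    define \<rho> where "\<rho> = representative I n"
    define Y where "Y k = stretched_data k \<rho> X" for k
    define I' where "I' k = map encode (Y k)" for k
    \<comment> \<open>The size of what each copy holds. \<open>D\<close> pays for it, so
      \<open>s \<le> T n\<close> and \<open>s \<le> S n\<close>, and fixed overheads can be measured
      in \<open>s\<close>.\<close>
    define s where "s = real n * (real ?L * real ?d)"
    have n: "0 < n" using X by (simp add: n_def)
    have len: "V \<noteq> [] \<and> length V \<le> m" if "V \<in> set X" for V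
      using that X by (auto simp: curves_upto_def)
    have \<rho>_less: "\<rho> i < n" for i using representative_less[OF n order_refl] by (simp add: \<rho>_def)
    have view_prep: "view k n \<rho> (I' k) I" if "k < ?K" for k
      using view_stretched[of k \<rho> X "[]"] that \<rho>_less len by (simp add: I'_def I_def Y_def n_def)
    have Y: "Y k \<noteq> []" "set (Y k) \<subseteq> point_sequences ?L" "length (Y k) = n" if "k < ?K" for k
      using X length_A[OF that] by (auto simp: Y_def stretched_data_def point_sequences_def n_def)
    have size_Y: "real (input_size (I' k)) = s" if "k < ?K" for k
    proof -
      have "input_size (I' k) = length (Y k) * (?L * ?d)" unfolding I'_def
        using Y(2)[OF that] by (intro input_size_encode_eq) (auto simp: point_sequences_def)
      then show ?thesis by (simp only: Y(3)[OF that] s_def of_nat_mult)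
    qed
    have sizes: "\<exists>i \<in> {1..m}. length (object I j) = i * ?d" if "j < length I" for j
      using len[of "X ! j"] that
      by (auto simp: I_def object_map_encode Suc_le_eq intro!: bexI[of _ "length (X ! j)"])
    have "\<forall>k. \<exists>t. k < ?K \<longrightarrow> halts_within (I' k) prep Map.empty t \<and> s + real t \<le> T n \<and>
      (\<forall>M \<in> set_pmf (memory_after (I' k) prep Map.empty t). s + real (card (dom M)) \<le> S n) \<and>
      (\<forall>q \<in> point_sequences ?L. \<exists>u.
         (\<forall>M \<in> set_pmf (memory_after (I' k) prep Map.empty t).
            halts_within (I' k @ [encode q]) query M u) \<and>
         real (length (encode q) + u) \<le> Q n \<and>
         measure_pmf.prob (bind_pmf (memory_after (I' k) prep Map.empty t)
           (\<lambda>M. memory_after (I' k @ [encode q]) query M u))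
           {M. \<not> ann_answer (lp_product_dist p) \<epsilon> (Y k) q (index_cell M 0)} < ?\<delta>)"
      (is "\<forall>k. \<exists>t. k < ?K \<longrightarrow> ?structure k t")
    proof
      fix k
      show "\<exists>t. k < ?K \<longrightarrow> ?structure k t"
      proof (cases "k < ?K")
        case True
        note Yk = Y[OF True]
        show ?thesis
          using ann_structureD[OF D Yk(1,2)] size_Y[OF True]
          unfolding Yk(3) I'_def by simp
      qed simp
    qed
    then obtain t where t: "\<And>k. k < ?K \<Longrightarrow> ?structure k (t k)" by metis
    have lenI: "length I = n" by (simp add: I_def n_def)
    let ?c = "19 + 2 * ?L"
    define C where "C = real ?c"
    have c: "C = 17 + 4 * real m" using m by (simp add: C_def of_nat_diff)
    define \<mu> where "\<mu> k = memory_after (I' k) prep Map.empty (t k)" for k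
    define t0 where "t0 = 4 + (9 * n + 1) + (\<Sum>k<?K. ?c * t k)"
    define \<nu> where "\<nu> = memory_after I (prep_prog prep) Map.empty t0"
    have prep: "couples (\<mu> k) I (prep_prog prep) Map.empty t0 (\<lambda>M N. low n \<rho> N \<and> part k N = M)"
      if "k < ?K" for k
      using couples_prep_prog[of I I' prep t k] sizes view_prep t n L that
      by (simp add: lenI \<mu>_def t0_def \<rho>_def)
    \<comment> \<open>Each coupling follows a single copy, but on every reachable memory these facts
      hold for all copies together; the query phase needs them so that every copy halts.\<close>
    have support: "low n \<rho> N \<and> part k N \<in> set_pmf (\<mu> k)" if "N \<in> set_pmf \<nu>" "k < ?K" for N k
      using triple_memory_after[OF couples_support[OF prep[OF that(2)]]] that(1)
      by (auto simp: \<nu>_def)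
    have wide: "m * ?d \<le> ?L * ?d" "1 \<le> ?L * ?d" using m by simp_all
    have n_le: "real n \<le> s" and m_le: "real m \<le> s" and s_pos: "0 < s"
    proof -
      have "n * 1 \<le> n * (?L * ?d)" using wide(2) by (rule mult_le_mono2)
      then have "real (n * 1) \<le> real (n * (?L * ?d))" by (rule of_nat_mono)
      then show "real n \<le> s" by (simp add: s_def)
      then show "0 < s" using n by simp
      have "1 * (m * 1) \<le> n * (?L * ?d)" using n m by (intro mult_le_mono) simp_all
      then have "real (1 * (m * 1)) \<le> real (n * (?L * ?d))" by (rule of_nat_mono)
      then show "real m \<le> s" by (simp add: s_def)
    qed
    have input: "real (input_size I) \<le> s"
    proof -
      have "input_size I \<le> n * (m * ?d)"
        using input_size_encode_le[of X m] len by (simp add: I_def n_def)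
      also have "\<dots> \<le> n * (?L * ?d)" using wide(1) by (rule mult_le_mono2)
      finally have "real (input_size I) \<le> real (n * (?L * ?d))" by (rule of_nat_mono)
      then show ?thesis by (simp only: s_def of_nat_mult)
    qed
    have sT: "s + real (t k) \<le> T n" if "k < ?K" for k using t[OF that] by blast
    have K1: "1 \<le> real ?K" using K by linarith
    \<comment> \<open>\<open>s + t k \<le> T n\<close> includes reading the stretched input, which a
      compiled copy does not do. The amount \<open>s\<close> released in each copy pays for reading
      \<open>I\<close> and for the scan: \<open>10 * s + 5\<close> is at most \<open>15 * s\<close>,
      and 15 is below the slowdown \<open>C\<close>.\<close>
    have time: "real (input_size I + t0) \<le> ?G * T n"
    proof -
      have Ts: "s \<le> T n" using sT[OF K] by simp
      have "(\<Sum>k<?K. real (t k)) \<le> real ?K * (T n - s)"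
        using sum_bounded_above[of "{..<?K}" "\<lambda>k. real (t k)" "T n - s"] sT by fastforce
      then have "C * (\<Sum>k<?K. real (t k)) \<le> C * (real ?K * (T n - s))"
        by (rule mult_left_mono) (simp add: C_def)
      moreover have "real t0 = 5 + 9 * real n + C * (\<Sum>k<?K. real (t k))"
        by (simp add: t0_def C_def sum_distrib_left)
      ultimately have "real (input_size I + t0) \<le> 10 * s + 5 + C * (real ?K * (T n - s))"
        using input n_le unfolding of_nat_add by linarith
      also have "\<dots> \<le> 15 * (real ?K * s) + C * (real ?K * (T n - s))"
      proof -
        have "1 \<le> s" using n_le n by linarith
        moreover have "1 * s \<le> real ?K * s" using K1 s_pos by (intro mult_right_mono) simp_all
        ultimately show ?thesis by linarith
      qed
      also have "\<dots> \<le> C * (real ?K * s) + C * (real ?K * (T n - s))"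
        using s_pos by (intro add_right_mono mult_right_mono) (simp_all add: c)
      also have "\<dots> = real ?K * (17 + 4 * real m) * T n" unfolding c by (simp add: algebra_simps)
      also have "\<dots> \<le> real ?K * (55 + 4 * real m) * T n"
        using Ts s_pos by (intro mult_right_mono mult_left_mono) simp_all
      also have "\<dots> \<le> ?G * T n" using G Ts s_pos by (intro mult_right_mono) simp_all
      finally show ?thesis .
    qed
    have space: "real (input_size I + card (dom N)) \<le> ?G * S n" if N: "N \<in> set_pmf \<nu>" for N
    proof -
      have small: "finite (dom (part k N)) \<and> real (card (dom (part k N))) \<le> S n - s \<and> s \<le> S n"
        if "k < ?K" for k
      proof -
        have M: "part k N \<in> set_pmf (\<mu> k)" using support[OF N that] by blast
        then have "s + real (card (dom (part k N))) \<le> S n" using t[OF that] by (simp add: \<mu>_def)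
        moreover have "finite (dom (part k N))"
          using M finite_dom_memory_after[of Map.empty] by (simp add: \<mu>_def)
        ultimately show ?thesis by linarith
      qed
      have Ss: "s \<le> S n" using small[OF K] by simp
      have "real (card (dom N)) \<le> 11 + real m + real ?K * (S n - s)"
        using small by (intro card_dom) simp
      \<comment> \<open>One \<open>s\<close> for the input, one for the \<open>m\<close>
        representatives and 11 for the other scratch cells, since \<open>1 \<le> s\<close>.\<close>
      then have "real (input_size I + card (dom N)) \<le> 13 * s + real ?K * (S n - s)"
        using input n_le m_le n by simp
      also have "\<dots> \<le> 13 * (real ?K * s) + real ?K * (S n - s)"
        using K1 s_pos by simp
      also have "\<dots> \<le> 13 * (real ?K * S n) + real ?K * S n"
        using Ss s_pos by (intro add_mono mult_left_mono) simp_all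
      also have "\<dots> = real ?K * 14 * S n" by simp
      also have "\<dots> \<le> real ?K * (55 + 4 * real m) * S n"
        using Ss s_pos by (intro mult_right_mono mult_left_mono) simp_all
      also have "\<dots> \<le> ?G * S n" using G Ss s_pos by (intro mult_right_mono) simp_all
      finally show ?thesis .
    qed
    have answers: "\<exists>u. (\<forall>N \<in> set_pmf \<nu>. halts_within (I @ [encode q]) (query_prog p query) N u) \<and>
      real (length (encode q) + u) \<le> ?G * Q n \<and>
      measure_pmf.prob (bind_pmf \<nu> (\<lambda>N. memory_after (I @ [encode q]) (query_prog p query) N u))
        {N. \<not> ann_answer (curve_dist p) \<epsilon> X q (index_cell N 0)} < 1 / 2"
      if "q \<in> curves_upto m" for q :: "(real ^ 'd) list"
    proof -
      have q: "q \<noteq> []" "length q \<le> m" using that by (auto simp: curves_upto_def)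
      define J where "J = I @ [encode q]"
      define q' where "q' k = stretch (query_table m k) q" for k
      define J' where "J' k = I' k @ [encode (q' k)]" for k
      have view: "view k n \<rho> (J' k) J" if "k < ?K" for k
        using view_stretched[of k \<rho> X "[q]"] that \<rho>_less len q
        by (auto simp: J'_def J_def I'_def I_def Y_def n_def q'_def)
      have q'_mem: "q' k \<in> point_sequences ?L" if "k < ?K" for k
        using length_B[OF that] by (simp add: q'_def point_sequences_def)
      have "\<forall>k. \<exists>u. k < ?K \<longrightarrow> (\<forall>M \<in> set_pmf (\<mu> k). halts_within (J' k) query M u) \<and>
        real (length (encode (q' k)) + u) \<le> Q n \<and>
        measure_pmf.prob (bind_pmf (\<mu> k) (\<lambda>M. memory_after (J' k) query M u))
          {M. \<not> ann_answer (lp_product_dist p) \<epsilon> (Y k) (q' k) (index_cell M 0)} < ?\<delta>"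
        using t q'_mem unfolding \<mu>_def J'_def by blast
      then obtain u where u: "\<And>k. k < ?K \<Longrightarrow> (\<forall>M \<in> set_pmf (\<mu> k). halts_within (J' k) query M (u k)) \<and>
        real (length (encode (q' k)) + u k) \<le> Q n \<and>
        measure_pmf.prob (bind_pmf (\<mu> k) (\<lambda>M. memory_after (J' k) query M (u k)))
          {M. \<not> ann_answer (lp_product_dist p) \<epsilon> (Y k) (q' k) (index_cell M 0)} < ?\<delta>"
        by metis
      define u0 where "u0 = 1 + (\<Sum>k<?K. ?c * u k + (25 + ?L * (7 * ?d + 4)))"
      have query: "couples (memory_after (J' h) query (part h N) (u h)) J (query_prog p query) N u0
        (\<lambda>M N'. best p n J N' \<and> dominated p n \<rho> J h M N')"
        if "N \<in> set_pmf \<nu>" "h < ?K" for N h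
        unfolding u0_def
      proof (rule couples_query_prog)
        show "low n \<rho> N" using support[OF that] by blast
        show "halts_within (J' k) query (part k N) (u k)" if k: "k < ?K" for k
          using u[OF k] support[OF \<open>N \<in> set_pmf \<nu>\<close> k] by blast
      qed (use n \<rho>_less L view that in auto)
      have halts: "\<forall>N \<in> set_pmf \<nu>. halts_within J (query_prog p query) N u0"
        using query K couples_halts by blast
      define w where "w = real ?L * real ?d"
      have w: "1 \<le> w" "real ?L \<le> w"
      proof -
        show "1 \<le> w" using of_nat_mono[OF wide(2), where 'a = real] by (simp only: w_def of_nat_mult of_nat_1)
        have "?L * 1 \<le> ?L * ?d" by (intro mult_le_mono2) simp
        then have "real (?L * 1) \<le> real (?L * ?d)" by (rule of_nat_mono)
        then show "real ?L \<le> w" by (simp add: w_def)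
      qed
      have uQ: "w + real (u k) \<le> Q n" if "k < ?K" for k
        using u[OF that] length_B[OF that] by (simp add: q'_def w_def)
      have query_time: "real (length (encode q) + u0) \<le> ?G * Q n"
      proof -
        have Qw: "w \<le> Q n" using uQ[OF K] by simp
        have "length q * ?d \<le> ?L * ?d" using q m by (intro mult_le_mono1) simp
        then have "real (length q * ?d) \<le> real (?L * ?d)" by (rule of_nat_mono)
        then have lenq: "real (length (encode q)) \<le> w" by (simp only: w_def of_nat_mult length_encode)
        \<comment> \<open>\<open>w\<close> is the size of the stretched query, which
          \<open>D\<close> has to read. From \<open>1 \<le> w\<close> and \<open>L \<le> w\<close>,
          the evaluation costs at most \<open>25 + 7 * w + 4 * w = 36 * w\<close>.\<close>
        have each: "real (?c * u k + (25 + ?L * (7 * ?d + 4))) \<le> (53 + 4 * real m) * Q n"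
          if "k < ?K" for k
        proof -
          have "real (?c * u k + (25 + ?L * (7 * ?d + 4))) =
            C * real (u k) + (25 + 7 * w + 4 * real ?L)"
          proof -
            have "real ((19 + 2 * l) * a + (25 + l * (7 * b + 4))) =
              real (19 + 2 * l) * real a + (25 + 7 * (real l * real b) + 4 * real l)" for l a b :: nat
              by (simp add: algebra_simps)
            then show ?thesis unfolding C_def w_def .
          qed
          also have "\<dots> \<le> C * Q n + 36 * w"
            using uQ[OF that] w by (intro add_mono mult_left_mono) (simp_all add: C_def)
          also have "\<dots> \<le> C * Q n + 36 * Q n" using Qw by simp
          also have "\<dots> = (53 + 4 * real m) * Q n" unfolding c by (simp add: algebra_simps)
          finally show ?thesis .
        qed
        have "real u0 = 1 + (\<Sum>k<?K. real (?c * u k + (25 + ?L * (7 * ?d + 4))))"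
          by (simp add: u0_def)
        also have "\<dots> \<le> 1 + real ?K * ((53 + 4 * real m) * Q n)"
          using sum_bounded_above[of "{..<?K}", OF each] by simp
        finally have "real (length (encode q) + u0) \<le> 2 * Q n + real ?K * ((53 + 4 * real m) * Q n)"
          using lenq w Qw by simp
        also have "\<dots> \<le> 2 * (real ?K * Q n) + real ?K * ((53 + 4 * real m) * Q n)"
          using K1 Qw w by simp
        also have "\<dots> = real ?K * (55 + 4 * real m) * Q n" by (simp add: algebra_simps)
        also have "\<dots> \<le> ?G * Q n" using G Qw w by (intro mult_right_mono) simp_all
        finally show ?thesis .
      qed
      have obj: "object J j = encode (X ! j)" if "j < n" for j
        using that by (simp add: J_def I_def object_append object_map_encode n_def)
      have obj_q: "object J n = encode q" by (simp add: J_def object_def nth_append lenI)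
      have candidate: "candidate k n J j \<longleftrightarrow> length (X ! j) = ?E k \<and> length q = ?F k" if "j < n" for k j
        using that by (simp add: candidate_def obj obj_q)
      obtain i where i: "i < n" "\<And>j. j < n \<Longrightarrow> curve_dist p q (X ! i) \<le> curve_dist p q (X ! j)"
        using ex_min_if_finite[of "(\<lambda>j. curve_dist p q (X ! j)) ` {..<n}"] n
        by (auto simp: not_less)
      have Xi: "X ! i \<noteq> []" "length (X ! i) \<le> m" using len[of "X ! i"] i by (auto simp: n_def)
      obtain W where W: "traversal (length q) (length (X ! i)) W"
        "curve_dist p q (X ! i) = traversal_cost p q (X ! i) W powr (1 / p)"
        using curve_dist_attained[OF q(1) Xi(1)] by metis
      then have "W \<in> set (walks m)" using q Xi m by (intro traversal_in_walks)
      then obtain h where h: "h < ?K" "walks m ! h = W" by (auto simp: in_set_conv_nth)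
      have lengths: "length q = ?F h" "length (X ! i) = ?E h"
        using W(1) h(2) by (auto simp: traversal_def)
      \<comment> \<open>The distance to the reported curve is at most the recorded cost, which
        belongs to a traversal. That is at most the cost of the candidate of copy \<open>h\<close>,
        whose product distance is within \<open>1 + \<epsilon>\<close> of the one for
        \<open>X ! i\<close>; the latter equals the curve distance, because \<open>W\<close> is
        optimal.\<close>
      have correct: "ann_answer (curve_dist p) \<epsilon> X q (index_cell N 0)"
        if N: "best p n J N" "dominated p n \<rho> J h M N"
          and M: "ann_answer (lp_product_dist p) \<epsilon> (Y h) (q' h) (index_cell M 0)" for M N
      proof -
        define j0 where "j0 = index_cell M 0"
        define j1 where "j1 = redirected h \<rho> J j0"
        have j0: "j0 < n" "\<And>j. j < n \<Longrightarrow> lp_product_dist p (q' h) (Y h ! j0) \<le>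
          (1 + \<epsilon>) * lp_product_dist p (q' h) (Y h ! j)"
          using M Y(3)[OF h(1)] by (auto simp: ann_answer_def j0_def)
        \<comment> \<open>\<open>X ! i\<close> itself has the required length, so the scan has found
          a representative of that length.\<close>
        have "length (object I (\<rho> (?E h))) = ?E h * ?d"
          unfolding \<rho>_def using i(1) lengths(2)
          by (intro representative_length[of i]) (simp_all add: I_def object_map_encode n_def)
        then have rep: "length (X ! \<rho> (?E h)) = ?E h"
          using \<rho>_less[of "?E h"] by (simp add: I_def object_map_encode n_def)
        have j1: "j1 = (if length (X ! j0) = ?E h then j0 else \<rho> (?E h))"
          using j0 by (simp add: j1_def redirected_def obj)
        have j1_less: "j1 < n" and j1_len: "length (X ! j1) = ?E h"
          using j1 j0 \<rho>_less rep by auto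
        have Yj0: "Y h ! j0 = stretch (data_table m h) (X ! j1)"
          using j0(1) j1 by (simp add: Y_def stretched_data_def n_def)
        have Yi: "Y h ! i = stretch (data_table m h) (X ! i)"
          using i(1) lengths(2) by (simp add: Y_def stretched_data_def n_def)
        have "candidate h n J j1" using j1_less j1_len lengths by (simp add: candidate)
        then have score_le: "score p h n J j1 \<le> cell N 2"
          using N(2) j0(1) by (simp add: dominated_def Let_def j0_def j1_def)
        then have "cell N 2 \<noteq> 0" using score_pos[of p h n J j1] by linarith
        then obtain k where k: "k < ?K" "candidate k n J (index_cell N 0)"
          "cell N 2 = score p k n J (index_cell N 0)"
          using N(1) by (auto simp: best_def)
        define j where "j = index_cell N 0"
        have j: "j < n" using k(2) by (simp add: candidate_def j_def)
        have j_len: "length (X ! j) = ?E k" "length q = ?F k"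
          using k(2) candidate[OF j] by (simp_all add: j_def)
        have cost_le: "cost p k (encode q) (encode (X ! j)) \<le> cost p h (encode q) (encode (X ! j1))"
        proof -
          have "1 / (1 + cost p h (encode q) (encode (X ! j1))) \<le> 1 / (1 + cost p k (encode q) (encode (X ! j)))"
            using score_le k(3) j j1_less by (simp add: score_def obj obj_q j_def)
          moreover have "0 < 1 + cost p h (encode q) (encode (X ! j1))"
            "0 < 1 + cost p k (encode q) (encode (X ! j))"
            using cost_nonneg by (simp_all add: add_pos_nonneg)
          ultimately show ?thesis by (simp add: divide_simps)
        qed
        have walk_cost: "cost p k (encode q) (encode V) = traversal_cost p q V (walks m ! k)"
          if "k < ?K" "length q = ?F k" "length V = ?E k" for k and V :: "(real ^ 'd) list"
          using cost_eq[OF refl that(1)] table_cost[OF that] by simp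
        have "traversal (length q) (length (X ! j)) (walks m ! k)"
          using walks_traversal(1)[of "walks m ! k" m] k(1) j_len by simp
        then have "curve_dist p q (X ! j) \<le> cost p k (encode q) (encode (X ! j)) powr (1 / p)"
          using walk_cost[OF k(1) j_len(2,1)] by (simp add: curve_dist_le)
        also have "\<dots> \<le> cost p h (encode q) (encode (X ! j1)) powr (1 / p)"
          using cost_le cost_nonneg assms(1) by (intro powr_mono2) simp_all
        also have "\<dots> = lp_product_dist p (q' h) (Y h ! j0)"
          unfolding Yj0 q'_def lp_product_dist_stretch[OF refl h(1)] ..
        also have "\<dots> \<le> (1 + \<epsilon>) * lp_product_dist p (q' h) (Y h ! i)" using j0(2) i(1) by blast
        also have "lp_product_dist p (q' h) (Y h ! i) = curve_dist p q (X ! i)"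
          unfolding Yi q'_def lp_product_dist_stretch[OF refl h(1)] W(2)
          using walk_cost[OF h(1) lengths] h(2) by simp
        finally have le: "curve_dist p q (X ! j) \<le> (1 + \<epsilon>) * curve_dist p q (X ! i)" .
        show ?thesis unfolding ann_answer_def j_def[symmetric] n_def[symmetric]
        proof (intro conjI allI impI j)
          fix i' assume "i' < n"
          then have "(1 + \<epsilon>) * curve_dist p q (X ! i) \<le> (1 + \<epsilon>) * curve_dist p q (X ! i')"
            using i(2) assms(2) by (intro mult_left_mono) simp_all
          with le show "curve_dist p q (X ! j) \<le> (1 + \<epsilon>) * curve_dist p q (X ! i')" by simp
        qed
      qed
      \<comment> \<open>The two phases are coupled in turn. The relation in between keeps membership
        in the support of \<open>\<nu>\<close>, from which the query phase draws the invariants of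
        all copies.\<close>
      have rel: "rel_pmf (\<lambda>M N. best p n J N \<and> dominated p n \<rho> J h M N)
        (bind_pmf (\<mu> h) (\<lambda>M. memory_after (J' h) query M (u h)))
        (bind_pmf \<nu> (\<lambda>N. memory_after J (query_prog p query) N u0))"
      proof (rule rel_pmf_bindI)
        show "rel_pmf (\<lambda>M N. N \<in> set_pmf \<nu> \<and> part h N = M) (\<mu> h) \<nu>"
          using couples_memory_after[OF prep[OF h(1)]] unfolding \<nu>_def
          by (rule pmf.rel_mono_strong) auto
        show "rel_pmf (\<lambda>M N. best p n J N \<and> dominated p n \<rho> J h M N)
          (memory_after (J' h) query M (u h)) (memory_after J (query_prog p query) N u0)"
          if "N \<in> set_pmf \<nu> \<and> part h N = M" for M N
          using couples_memory_after[OF query[of N h]] that h(1) by auto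
      qed
      let ?good' = "{M. ann_answer (lp_product_dist p) \<epsilon> (Y h) (q' h) (index_cell M 0)}"
      let ?good = "{N. ann_answer (curve_dist p) \<epsilon> X q (index_cell N 0)}"
      have "measure_pmf.prob (bind_pmf \<nu> (\<lambda>N. memory_after J (query_prog p query) N u0)) (- ?good)
        \<le> measure_pmf.prob (bind_pmf (\<mu> h) (\<lambda>M. memory_after (J' h) query M (u h))) (- ?good')"
        using rel by (rule rel_pmf_prob_le) (use correct in auto)
      also have "\<dots> < ?\<delta>" using u[OF h(1)] by (simp add: Collect_neg_eq)
      also have "\<dots> \<le> 2 powr - 1" using m by (intro powr_mono) simp_all
      also have "\<dots> = 1 / (2 :: real)" by (simp add: powr_minus_divide)
      finally have "measure_pmf.prob (bind_pmf \<nu> (\<lambda>N. memory_after J (query_prog p query) N u0))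
        {N. \<not> ann_answer (curve_dist p) \<epsilon> X q (index_cell N 0)} < 1 / 2"
        by (simp add: Collect_neg_eq)
      with halts query_time show ?thesis unfolding J_def by blast
    qed
    have "halts_within I (prep_prog prep) Map.empty t0" using couples_halts[OF prep[OF K]] .
    then show "let n = length X; I = map encode X in
        \<exists>t. halts_within I (prep_prog prep) Map.empty t \<and>
            real (input_size I + t) \<le> ?G * T n \<and>
            (\<forall>M \<in> set_pmf (memory_after I (prep_prog prep) Map.empty t).
               real (input_size I + card (dom M)) \<le> ?G * S n) \<and>
            (\<forall>q \<in> curves_upto m. let J = I @ [encode q] in
               \<exists>u. (\<forall>M \<in> set_pmf (memory_after I (prep_prog prep) Map.empty t).
                      halts_within J (query_prog p query) M u) \<and>
                   real (length (encode q) + u) \<le> ?G * Q n \<and>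
                   measure_pmf.prob
                     (bind_pmf (memory_after I (prep_prog prep) Map.empty t)
                       (\<lambda>M. memory_after J (query_prog p query) M u))
                     {M. \<not> ann_answer (curve_dist p) \<epsilon> X q (index_cell M 0)} < 1 / 2)"
      unfolding Let_def n_def[symmetric] I_def[symmetric]
      using time space answers unfolding \<nu>_def by blast
  qed
  then show ?thesis by blast
qed

end
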